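(* There exists a finite matrix $\widetilde M\in\{-1,+1\}^{m\times N}$ with weak-learning margin $\gamma(\widetilde M)=\frac15>0$ such that exhaustive AdaBoost on $\widetilde M$ with smallest-index tie-breaking, started from the exact uniform distribution $D_1(i)=1/m$ for all $i$, does not converge to any finite cycle.
   Context: Exhaustive AdaBoost on a matrix $M\in\{-1,+1\}^{m\times N}$: given a state $D_t\in\Delta^{m-1}$ (the probability simplex in $\mathbb R^m$), the edges are $\mu_t(j)=(D_t^\top M)_j$, the selected column is $j_t=\min\operatorname{argmax}_{1\le j\le N}\mu_t(j)$ (smallest-index tie-breaking), $r_t=\mu_t(j_t)$, and the update is $D_{t+1}(i)=D_t(i)/(1+r_tM_{ij_t})$. The weak-learning margin is $\gamma(M)=\min_{D\in\Delta^{m-1}}\max_{1\le j\le N}(D^\top M)_j$. The sequence $(D_t)_{t\ge1}$ converges to a cycle of length $\ell\ge1$ if there exist $\widetilde D_0,\dots,\widetilde D_{\ell-1}$ with $D_{k\ell+b}\to\widetilde D_b$ as $k\to\infty$ for every $b\in\{0,\dots,\ell-1\}$; it converges to a finite cycle if it converges to a cycle of some finite length $\ell$. *)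

theory Defs
  imports "HOL-Analysis.Analysis"
begin

text \<open>Matrices M in {-1,+1}^(m x N) are represented as functions nat => nat => real,
  with row index i < m and column index j < N. Distributions D in the prob_simplex are
  functions nat => real, only the values at i < m being relevant.\<close>

definition pm1_matrix :: "nat \<Rightarrow> nat \<Rightarrow> (nat \<Rightarrow> nat \<Rightarrow> real) \<Rightarrow> bool" where
  "pm1_matrix m N M \<longleftrightarrow> (\<forall>i<m. \<forall>j<N. M i j = 1 \<or> M i j = -1)"

definition prob_simplex :: "nat \<Rightarrow> (nat \<Rightarrow> real) set" where
  "prob_simplex m = {D. (\<forall>i<m. 0 \<le> D i) \<and> (\<Sum>i<m. D i) = 1}"

definition edge :: "nat \<Rightarrow> (nat \<Rightarrow> nat \<Rightarrow> real) \<Rightarrow> (nat \<Rightarrow> real) \<Rightarrow> nat \<Rightarrow> real" where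
  "edge m M D j = (\<Sum>i<m. D i * M i j)"

definition margin :: "nat \<Rightarrow> nat \<Rightarrow> (nat \<Rightarrow> nat \<Rightarrow> real) \<Rightarrow> real" where
  "margin m N M = (INF D\<in>prob_simplex m. Max ((\<lambda>j. edge m M D j) ` {..<N}))"

definition sel_col :: "nat \<Rightarrow> nat \<Rightarrow> (nat \<Rightarrow> nat \<Rightarrow> real) \<Rightarrow> (nat \<Rightarrow> real) \<Rightarrow> nat" where
  "sel_col m N M D = (LEAST j. j < N \<and> (\<forall>k<N. edge m M D k \<le> edge m M D j))"

definition ada_step :: "nat \<Rightarrow> nat \<Rightarrow> (nat \<Rightarrow> nat \<Rightarrow> real) \<Rightarrow> (nat \<Rightarrow> real) \<Rightarrow> (nat \<Rightarrow> real)" where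
  "ada_step m N M D = (let j = sel_col m N M D; r = edge m M D j
     in (\<lambda>i. D i / (1 + r * M i j)))"

primrec ada_iter :: "nat \<Rightarrow> nat \<Rightarrow> (nat \<Rightarrow> nat \<Rightarrow> real) \<Rightarrow> nat \<Rightarrow> (nat \<Rightarrow> real)" where
  "ada_iter m N M 0 = (\<lambda>i. 1 / real m)"
| "ada_iter m N M (Suc k) = ada_step m N M (ada_iter m N M k)"

text \<open>The paper's D_t for t >= 1 (D_1 uniform).\<close>
definition adaD :: "nat \<Rightarrow> nat \<Rightarrow> (nat \<Rightarrow> nat \<Rightarrow> real) \<Rightarrow> nat \<Rightarrow> (nat \<Rightarrow> real)" where
  "adaD m N M t = ada_iter m N M (t - 1)"

definition conv_cycle :: "nat \<Rightarrow> (nat \<Rightarrow> (nat \<Rightarrow> real)) \<Rightarrow> nat \<Rightarrow> bool" where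
  "conv_cycle m D l \<longleftrightarrow> l \<ge> 1 \<and>
     (\<exists>Dt :: nat \<Rightarrow> nat \<Rightarrow> real. \<forall>b<l. \<forall>i<m. (\<lambda>k. D (k * l + b) i) \<longlonglongrightarrow> Dt b i)"

definition conv_finite_cycle :: "nat \<Rightarrow> (nat \<Rightarrow> (nat \<Rightarrow> real)) \<Rightarrow> bool" where
  "conv_finite_cycle m D \<longleftrightarrow> (\<exists>l. conv_cycle m D l)"

end

(*
  If rows are pairs (r1, r2) and every column depends on one component only, a product distribution
  stays a product, and AdaBoost runs the two factors independently: at each round the factor with the
  larger maximal edge moves. Each factor used here converges to a cycle of length 10 with the same
  minimal edge 5/16, attained once per cycle, which is approached from above with an error of exact
  order kappa^(-c) after c cycles. A factor whose next edge is the minimal one waits until its excess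
  over 5/16 is the larger of the two, so cycles of the two factors are interleaved by sorting the
  excesses. Convergence to a finite cycle would make this interleaving eventually periodic, hence
  kappa1^p = kappa2^q for some p, q > 0; but kappa1 = 5 and kappa2 = 56/11.

  In each factor all rows but one have two entries -1. Rescaling column j by v_j, the row with entries
  -1 in columns a, b has weight proportional to c_ab v_a v_b, and a boosting step at column j replaces
  v_j by the solution of a linear equation. The c_ab are chosen so that ten steps multiply
  V = (1,...,1) by kappa. The remaining row has a single entry -1 and contributes a term linear in v,
  hence a perturbation V + h y in which h is divided by about kappa in every cycle. As h tends to 0
  the induced map on y tends to an affine map that sends a box into its interior, so y stays in the
  box, where the excess over 5/16 is positive to first order in h. Integral weights are realised by
  repeating rows.
*)

theory Submission
  imports Defs
begin

section \<open>AdaBoost steps and margins\<close>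

definition top_edge :: "nat \<Rightarrow> nat \<Rightarrow> (nat \<Rightarrow> nat \<Rightarrow> real) \<Rightarrow> (nat \<Rightarrow> real) \<Rightarrow> real" where
  "top_edge m N M D = Max (edge m M D ` {..<N})"

lemma edge_le_top_edge: "j < N \<Longrightarrow> edge m M D j \<le> top_edge m N M D"
  by (auto simp: top_edge_def intro: Max_ge)

lemma top_edge_eqI:
  assumes "j < N" "\<And>k. k < N \<Longrightarrow> edge m M D k \<le> edge m M D j"
  shows "top_edge m N M D = edge m M D j"
  unfolding top_edge_def using assms by (intro Max_eqI) auto

lemma edge_cong: "edge m M D = edge m M D'"
  and top_edge_cong: "top_edge m N M D = top_edge m N M D'"
  and sel_col_cong: "sel_col m N M D = sel_col m N M D'"
  if "\<And>i. i < m \<Longrightarrow> D i = D' i"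
proof -
  show "edge m M D = edge m M D'" using that by (auto simp: edge_def fun_eq_iff)
  then show "top_edge m N M D = top_edge m N M D'" "sel_col m N M D = sel_col m N M D'"
    by (simp_all add: top_edge_def sel_col_def)
qed

lemma sel_col_less: "sel_col m N M D < N"
  and edge_sel_col: "edge m M D (sel_col m N M D) = top_edge m N M D"
  if "0 < N"
proof -
  let ?P = "\<lambda>j. j < N \<and> (\<forall>k<N. edge m M D k \<le> edge m M D j)"
  have "top_edge m N M D \<in> edge m M D ` {..<N}"
    unfolding top_edge_def using that by (intro Max_in) auto
  then obtain j where "j < N" "top_edge m N M D = edge m M D j"
    by auto
  then have "?P j"
    using edge_le_top_edge by metis
  then have "?P (sel_col m N M D)"
    unfolding sel_col_def by (rule LeastI)
  then show "sel_col m N M D < N" "edge m M D (sel_col m N M D) = top_edge m N M D"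
    using top_edge_eqI by metis+
qed

lemma edge_less_top_edge:
  assumes "k < sel_col m N M D" "0 < N"
  shows "edge m M D k < top_edge m N M D"
proof (rule ccontr)
  assume "\<not> ?thesis"
  then have "\<forall>i<N. edge m M D i \<le> edge m M D k"
    using edge_le_top_edge[of _ N m M D] by fastforce
  then have "sel_col m N M D \<le> k"
    unfolding sel_col_def using sel_col_less[OF assms(2), of m M D] assms(1)
    by (intro Least_le) auto
  then show False using assms(1) by simp
qed

lemma sel_col_eqI:
  assumes "j < N" "edge m M D j = top_edge m N M D"
    and "\<And>k. k < j \<Longrightarrow> edge m M D k < top_edge m N M D"
  shows "sel_col m N M D = j"
  unfolding sel_col_def
proof (rule Least_equality)
  fix i assume "i < N \<and> (\<forall>k<N. edge m M D k \<le> edge m M D i)"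
  then show "j \<le> i" using assms by (metis leD leI)
qed (use assms edge_le_top_edge in auto)

lemma ada_step_eq:
  assumes "0 < N"
  shows "ada_step m N M D i = D i / (1 + top_edge m N M D * M i (sel_col m N M D))"
  using assms by (simp add: ada_step_def edge_sel_col Let_def)

lemma inverse_one_plus_sign:
  fixes r x :: real
  assumes "x = 1 \<or> x = -1" "\<bar>r\<bar> < 1"
  shows "1 / (1 + r * x) = (1 - r * x) / (1 - r\<^sup>2)"
proof -
  have "1 + r > 0" "1 - r > 0" using assms(2) by auto
  moreover have "1 - r\<^sup>2 = (1 - r) * (1 + r)" by (simp add: power2_eq_square algebra_simps)
  ultimately show ?thesis using assms(1) by auto
qed

lemma sum_ada_step: "(\<Sum>i<m. ada_step m N M D i) = 1"
  and edge_ada_step_sel_col: "edge m M (ada_step m N M D) (sel_col m N M D) = 0"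
  if pm1: "pm1_matrix m N M" and N: "0 < N" and total: "(\<Sum>i<m. D i) = 1"
    and bound: "\<bar>top_edge m N M D\<bar> < 1"
proof -
  define r j where "r = top_edge m N M D" and "j = sel_col m N M D"
  have sign: "M i j = 1 \<or> M i j = -1" if "i < m" for i
    using pm1 sel_col_less[OF N] that by (auto simp: pm1_matrix_def j_def)
  have edge: "(\<Sum>i<m. D i * M i j) = r"
    using edge_sel_col[OF N, of m M D] by (simp add: r_def j_def edge_def)
  have r: "1 - r\<^sup>2 \<noteq> 0"
    using bound abs_square_less_1[of r] by (simp add: r_def)
  have step: "ada_step m N M D i = (D i - r * (D i * M i j)) / (1 - r\<^sup>2)" if "i < m" for i
  proof -
    have "ada_step m N M D i = D i * (1 / (1 + r * M i j))"
      by (simp add: ada_step_eq[OF N] r_def j_def)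
    also have "\<dots> = D i * ((1 - r * M i j) / (1 - r\<^sup>2))"
      using inverse_one_plus_sign[OF sign[OF that]] bound by (simp add: r_def)
    finally show ?thesis by (simp add: algebra_simps)
  qed
  have "(\<Sum>i<m. ada_step m N M D i) = ((\<Sum>i<m. D i) - r * (\<Sum>i<m. D i * M i j)) / (1 - r\<^sup>2)"
    by (simp add: step sum_subtractf sum_distrib_left sum_divide_distrib[symmetric])
  then show "(\<Sum>i<m. ada_step m N M D i) = 1"
    using r by (simp add: total edge power2_eq_square)
  have "ada_step m N M D i * M i j = (D i * M i j - r * D i) / (1 - r\<^sup>2)" if "i < m" for i
    using sign[OF that] by (auto simp: step[OF that] algebra_simps)
  then have "edge m M (ada_step m N M D) j
      = ((\<Sum>i<m. D i * M i j) - r * (\<Sum>i<m. D i)) / (1 - r\<^sup>2)"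
    by (simp add: edge_def sum_subtractf sum_distrib_left sum_divide_distrib[symmetric])
  then show "edge m M (ada_step m N M D) (sel_col m N M D) = 0"
    by (simp add: edge total j_def[symmetric])
qed

definition regular_run :: "nat \<Rightarrow> nat \<Rightarrow> (nat \<Rightarrow> nat \<Rightarrow> real) \<Rightarrow> bool" where
  "regular_run m N M \<longleftrightarrow> 0 < m \<and> 0 < N \<and> pm1_matrix m N M \<and>
     (\<forall>k. \<bar>top_edge m N M (ada_iter m N M k)\<bar> < 1)"

lemma sum_ada_iter:
  assumes "regular_run m N M"
  shows "(\<Sum>i<m. ada_iter m N M k i) = 1"
proof (induction k)
  case 0
  then show ?case using assms by (simp add: regular_run_def)
next
  case (Suc k)
  then show ?case using assms by (auto simp: regular_run_def intro!: sum_ada_step)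
qed

lemma edge_ge_minus_one:
  assumes "pm1_matrix m N M" "j < N" "D \<in> prob_simplex m"
  shows "-1 \<le> edge m M D j"
proof -
  have "(\<Sum>i<m. D i * (-1)) \<le> (\<Sum>i<m. D i * M i j)"
    using assms by (intro sum_mono mult_left_mono) (force simp: pm1_matrix_def prob_simplex_def)+
  then show ?thesis using assms(3) by (simp add: edge_def prob_simplex_def sum_negf)
qed

lemma margin_le_top_edge:
  assumes "pm1_matrix m N M" "0 < N" "D \<in> prob_simplex m"
  shows "margin m N M \<le> top_edge m N M D"
proof -
  have "-1 \<le> top_edge m N M E" if "E \<in> prob_simplex m" for E
    using edge_ge_minus_one[OF assms(1,2) that] edge_le_top_edge[OF assms(2)] by (rule order_trans)
  then show ?thesis
    unfolding margin_def top_edge_def[symmetric] using assms(3)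
    by (intro cINF_lower bdd_belowI2[where m = "-1"])
qed

lemma prob_simplex_nonempty: "0 < m \<Longrightarrow> prob_simplex m \<noteq> {}"
  by (auto simp: prob_simplex_def intro!: exI[of _ "\<lambda>i. 1 / real m"])

lemma margin_greatest:
  assumes "0 < m" "\<And>D. D \<in> prob_simplex m \<Longrightarrow> \<rho> \<le> top_edge m N M D"
  shows "\<rho> \<le> margin m N M"
  unfolding margin_def top_edge_def[symmetric]
  using assms prob_simplex_nonempty by (intro cINF_greatest)

lemma margin_approx:
  assumes "0 < m" "0 < \<epsilon>"
  obtains D where "D \<in> prob_simplex m" "top_edge m N M D < margin m N M + \<epsilon>"
proof -
  have "\<exists>e\<in>top_edge m N M ` prob_simplex m. e < margin m N M + \<epsilon>"
    using assms prob_simplex_nonempty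
    by (intro cInf_lessD) (auto simp: margin_def top_edge_def[abs_def])
  then show ?thesis using that by blast
qed

lemma margin_ge_average_row_sum:
  assumes "0 < m" "0 < N" "\<And>i. i < m \<Longrightarrow> real N * \<rho> \<le> (\<Sum>j<N. M i j)"
  shows "\<rho> \<le> margin m N M"
  using assms(1)
proof (rule margin_greatest)
  fix D assume D: "D \<in> prob_simplex m"
  have "real N * \<rho> = (\<Sum>i<m. D i * (real N * \<rho>))"
    using D sum_distrib_right[of D "{..<m}" "real N * \<rho>"] by (simp add: prob_simplex_def)
  also have "\<dots> \<le> (\<Sum>i<m. D i * (\<Sum>j<N. M i j))"
    using D assms(3) by (intro sum_mono mult_left_mono) (auto simp: prob_simplex_def)
  also have "\<dots> = (\<Sum>j<N. edge m M D j)"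
    unfolding edge_def sum_distrib_left by (rule sum.swap)
  also have "\<dots> \<le> (\<Sum>j<N. top_edge m N M D)"
    by (intro sum_mono edge_le_top_edge) auto
  finally show "\<rho> \<le> top_edge m N M D" using assms(2) by simp
qed

section \<open>Product matrices\<close>

text \<open>Rows \<open>i < m1 * m2\<close> encode the pairs \<open>(i mod m1, i div m1)\<close>.\<close>

definition prod_mat ::
  "nat \<Rightarrow> nat \<Rightarrow> (nat \<Rightarrow> nat \<Rightarrow> real) \<Rightarrow> (nat \<Rightarrow> nat \<Rightarrow> real) \<Rightarrow> nat \<Rightarrow> nat \<Rightarrow> real" where
  "prod_mat m1 N1 M1 M2 i j = (if j < N1 then M1 (i mod m1) j else M2 (i div m1) (j - N1))"

definition prod_dist :: "nat \<Rightarrow> (nat \<Rightarrow> real) \<Rightarrow> (nat \<Rightarrow> real) \<Rightarrow> nat \<Rightarrow> real" where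
  "prod_dist m1 p q i = p (i mod m1) * q (i div m1)"

definition fst_marginal :: "nat \<Rightarrow> nat \<Rightarrow> (nat \<Rightarrow> real) \<Rightarrow> nat \<Rightarrow> real" where
  "fst_marginal m1 m2 D a = (\<Sum>b<m2. D (a + m1 * b))"

definition snd_marginal :: "nat \<Rightarrow> nat \<Rightarrow> (nat \<Rightarrow> real) \<Rightarrow> nat \<Rightarrow> real" where
  "snd_marginal m1 m2 D b = (\<Sum>a<m1. D (a + m1 * b))"

lemma sum_mod_div:
  fixes f :: "nat \<Rightarrow> nat \<Rightarrow> 'a :: comm_monoid_add"
  shows "(\<Sum>i<m1 * m2. f (i mod m1) (i div m1)) = (\<Sum>a<m1. \<Sum>b<m2. f a b)"
proof -
  have "(\<Sum>i<m1 * m2. f (i mod m1) (i div m1))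
      = (\<Sum>b<m2. \<Sum>i = b * m1..<b * m1 + m1. f (i mod m1) (i div m1))"
    by (simp add: sum.nat_group mult.commute)
  also have "\<dots> = (\<Sum>b<m2. \<Sum>a<m1. f a b)"
  proof (rule sum.cong[OF refl])
    fix b
    have "(\<Sum>i = b * m1..<b * m1 + m1. f (i mod m1) (i div m1))
        = (\<Sum>a<m1. f ((a + b * m1) mod m1) ((a + b * m1) div m1))"
      using sum.shift_bounds_nat_ivl[of "\<lambda>i. f (i mod m1) (i div m1)" 0 "b * m1" m1]
      by (simp add: add.commute atLeast0LessThan)
    also have "\<dots> = (\<Sum>a<m1. f a b)" by (rule sum.cong) auto
    finally show "(\<Sum>i = b * m1..<b * m1 + m1. f (i mod m1) (i div m1)) = (\<Sum>a<m1. f a b)" .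
  qed
  also have "\<dots> = (\<Sum>a<m1. \<Sum>b<m2. f a b)" by (rule sum.swap)
  finally show ?thesis .
qed

lemma mod_div_less:
  assumes "i < m1 * (m2 :: nat)"
  shows "i mod m1 < m1" "i div m1 < m2"
  using assms by (cases "m1 = 0"; simp add: less_mult_imp_div_less mult.commute)+

lemma add_mult_less:
  assumes "a < m1" "b < (m2 :: nat)"
  shows "a + m1 * b < m1 * m2"
proof -
  have "a + m1 * b < m1 * Suc b" using assms(1) by simp
  also have "\<dots> \<le> m1 * m2" using assms(2) by (intro mult_le_mono2) simp
  finally show ?thesis .
qed

lemma pm1_matrix_prod_mat:
  assumes "pm1_matrix m1 N1 M1" "pm1_matrix m2 N2 M2"
  shows "pm1_matrix (m1 * m2) (N1 + N2) (prod_mat m1 N1 M1 M2)"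
  using assms mod_div_less[of _ m1 m2] by (auto simp: pm1_matrix_def prod_mat_def)

lemma edge_prod_mat:
  shows edge_prod_mat_left: "j < N1 \<Longrightarrow>
      edge (m1 * m2) (prod_mat m1 N1 M1 M2) D j = edge m1 M1 (fst_marginal m1 m2 D) j"
    and edge_prod_mat_right:
      "edge (m1 * m2) (prod_mat m1 N1 M1 M2) D (N1 + j) = edge m2 M2 (snd_marginal m1 m2 D) j"
proof -
  have "(\<Sum>i<m1 * m2. D i * M1 (i mod m1) j)
      = (\<Sum>i<m1 * m2. D (i mod m1 + m1 * (i div m1)) * M1 (i mod m1) j)"
    by simp
  also have "\<dots> = (\<Sum>a<m1. \<Sum>b<m2. D (a + m1 * b) * M1 a j)"
    by (rule sum_mod_div)
  finally show "edge (m1 * m2) (prod_mat m1 N1 M1 M2) D j = edge m1 M1 (fst_marginal m1 m2 D) j"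
    if "j < N1" using that by (simp add: edge_def prod_mat_def fst_marginal_def sum_distrib_right)
  have "(\<Sum>i<m1 * m2. D i * M2 (i div m1) j)
      = (\<Sum>i<m1 * m2. D (i mod m1 + m1 * (i div m1)) * M2 (i div m1) j)"
    by simp
  also have "\<dots> = (\<Sum>a<m1. \<Sum>b<m2. D (a + m1 * b) * M2 b j)"
    by (rule sum_mod_div)
  also have "\<dots> = (\<Sum>b<m2. \<Sum>a<m1. D (a + m1 * b) * M2 b j)"
    by (rule sum.swap)
  finally show "edge (m1 * m2) (prod_mat m1 N1 M1 M2) D (N1 + j) = edge m2 M2 (snd_marginal m1 m2 D) j"
    by (simp add: edge_def prod_mat_def snd_marginal_def sum_distrib_right)
qed

lemma top_edge_prod_mat:
  assumes "0 < N1" "0 < N2"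
  shows "top_edge (m1 * m2) (N1 + N2) (prod_mat m1 N1 M1 M2) D
    = max (top_edge m1 N1 M1 (fst_marginal m1 m2 D)) (top_edge m2 N2 M2 (snd_marginal m1 m2 D))"
proof -
  have "{..<N1 + N2} = {..<N1} \<union> (\<lambda>j. N1 + j) ` {..<N2}"
    by (simp add: lessThan_atLeast0 ivl_disj_un(17) add.commute)
  then have "edge (m1 * m2) (prod_mat m1 N1 M1 M2) D ` {..<N1 + N2}
      = edge m1 M1 (fst_marginal m1 m2 D) ` {..<N1} \<union> edge m2 M2 (snd_marginal m1 m2 D) ` {..<N2}"
    by (simp add: image_Un image_image edge_prod_mat cong: image_cong_simp)
  then show ?thesis using assms by (simp add: top_edge_def Max_Un lessThan_empty_iff)
qed

lemma marginals_in_prob_simplex: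
  assumes "D \<in> prob_simplex (m1 * m2)"
  shows "fst_marginal m1 m2 D \<in> prob_simplex m1" "snd_marginal m1 m2 D \<in> prob_simplex m2"
proof -
  have "(\<Sum>a<m1. \<Sum>b<m2. D (a + m1 * b)) = (\<Sum>i<m1 * m2. D i)"
    using sum_mod_div[of "\<lambda>a b. D (a + m1 * b)" m1 m2] by simp
  then show "fst_marginal m1 m2 D \<in> prob_simplex m1" "snd_marginal m1 m2 D \<in> prob_simplex m2"
    using assms add_mult_less sum.swap[of "\<lambda>a b. D (a + m1 * b)" "{..<m2}" "{..<m1}"]
    by (auto simp: prob_simplex_def fst_marginal_def snd_marginal_def intro!: sum_nonneg)
qed

lemma prod_dist_in_prob_simplex:
  assumes "p \<in> prob_simplex m1" "q \<in> prob_simplex m2"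
  shows "prod_dist m1 p q \<in> prob_simplex (m1 * m2)"
  using assms mod_div_less[of _ m1 m2] sum_mod_div[of "\<lambda>a b. p a * q b" m1 m2]
  by (auto simp: prob_simplex_def prod_dist_def sum_product[symmetric])

lemma marginals_prod_dist:
  assumes "\<And>i. i < m1 * m2 \<Longrightarrow> D i = prod_dist m1 p q i"
    and "(\<Sum>a<m1. p a) = 1" "(\<Sum>b<m2. q b) = 1"
  shows "a < m1 \<Longrightarrow> fst_marginal m1 m2 D a = p a" "b < m2 \<Longrightarrow> snd_marginal m1 m2 D b = q b"
proof -
  have D: "D (a + m1 * b) = p a * q b" if "a < m1" "b < m2" for a b
    using that by (simp add: assms(1) add_mult_less prod_dist_def)
  show "fst_marginal m1 m2 D a = p a" if "a < m1"
    using that assms(3) by (simp add: fst_marginal_def D flip: sum_distrib_left)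
  show "snd_marginal m1 m2 D b = q b" if "b < m2"
    using that assms(2) by (simp add: snd_marginal_def D flip: sum_distrib_right)
qed

lemma margin_prod_mat:
  assumes "pm1_matrix m1 N1 M1" "pm1_matrix m2 N2 M2" "0 < m1" "0 < m2" "0 < N1" "0 < N2"
  shows "margin (m1 * m2) (N1 + N2) (prod_mat m1 N1 M1 M2) = max (margin m1 N1 M1) (margin m2 N2 M2)"
    (is "margin ?m ?N ?M = ?\<rho>")
proof (rule antisym)
  show "margin ?m ?N ?M \<le> ?\<rho>"
  proof (rule field_le_epsilon)
    fix \<epsilon> :: real assume "0 < \<epsilon>"
    obtain p where p: "p \<in> prob_simplex m1" "top_edge m1 N1 M1 p < margin m1 N1 M1 + \<epsilon>"
      using \<open>0 < m1\<close> \<open>0 < \<epsilon>\<close> by (rule margin_approx)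
    obtain q where q: "q \<in> prob_simplex m2" "top_edge m2 N2 M2 q < margin m2 N2 M2 + \<epsilon>"
      using \<open>0 < m2\<close> \<open>0 < \<epsilon>\<close> by (rule margin_approx)
    have total: "(\<Sum>a<m1. p a) = 1" "(\<Sum>b<m2. q b) = 1"
      using p(1) q(1) by (auto simp: prob_simplex_def)
    have "margin ?m ?N ?M \<le> top_edge ?m ?N ?M (prod_dist m1 p q)"
      using assms p(1) q(1) by (intro margin_le_top_edge pm1_matrix_prod_mat prod_dist_in_prob_simplex) auto
    also have "\<dots> = max (top_edge m1 N1 M1 p) (top_edge m2 N2 M2 q)"
      unfolding top_edge_prod_mat[OF assms(5,6)]
      by (intro arg_cong2[where f = max] top_edge_cong marginals_prod_dist[OF refl total])
    finally show "margin ?m ?N ?M \<le> ?\<rho> + \<epsilon>" using p(2) q(2) by linarith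
  qed
next
  show "?\<rho> \<le> margin ?m ?N ?M"
  proof (rule margin_greatest)
    fix D assume "D \<in> prob_simplex ?m"
    then show "?\<rho> \<le> top_edge ?m ?N ?M D"
      unfolding top_edge_prod_mat[OF assms(5,6)] using assms
      by (intro max.mono margin_le_top_edge marginals_in_prob_simplex)
  qed (use assms in simp)
qed

lemma sel_col_prod_mat:
  fixes m1 m2 D
  assumes "0 < N1" "0 < N2"
  defines "p \<equiv> fst_marginal m1 m2 D" and "q \<equiv> snd_marginal m1 m2 D"
  shows "sel_col (m1 * m2) (N1 + N2) (prod_mat m1 N1 M1 M2) D
    = (if top_edge m2 N2 M2 q \<le> top_edge m1 N1 M1 p then sel_col m1 N1 M1 p
       else N1 + sel_col m2 N2 M2 q)"
proof -
  let ?e = "edge (m1 * m2) (prod_mat m1 N1 M1 M2) D"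
  note top = top_edge_prod_mat[OF assms(1,2), of m1 m2 M1 M2 D, folded p_def q_def]
  have left: "?e j = edge m1 M1 p j" if "j < N1" for j
    unfolding p_def using that by (rule edge_prod_mat_left)
  have right: "?e (N1 + j) = edge m2 M2 q j" for j
    unfolding q_def by (rule edge_prod_mat_right)
  show ?thesis
  proof (cases "top_edge m2 N2 M2 q \<le> top_edge m1 N1 M1 p")
    case True
    have "sel_col m1 N1 M1 p < N1" using assms(1) by (rule sel_col_less)
    then have "sel_col (m1 * m2) (N1 + N2) (prod_mat m1 N1 M1 M2) D = sel_col m1 N1 M1 p"
      using True assms(1) by (intro sel_col_eqI) (auto simp: top left edge_sel_col edge_less_top_edge)
    then show ?thesis using True by simp
  next
    case False
    have "?e k < top_edge m2 N2 M2 q" if "k < N1 + sel_col m2 N2 M2 q" for k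
    proof (cases "k < N1")
      case True
      then show ?thesis using False edge_le_top_edge[OF True, of m1 M1 p] by (simp add: left)
    next
      case ge: False
      then show ?thesis
        using right[of "k - N1"] that assms(2) by (simp add: edge_less_top_edge)
    qed
    then have "sel_col (m1 * m2) (N1 + N2) (prod_mat m1 N1 M1 M2) D = N1 + sel_col m2 N2 M2 q"
      using False assms(2) sel_col_less[OF assms(2), of m2 M2 q]
      by (intro sel_col_eqI) (auto simp: top right edge_sel_col)
    then show ?thesis using False by simp
  qed
qed

lemma ada_step_prod_mat:
  assumes N: "0 < N1" "0 < N2" and total: "(\<Sum>a<m1. p a) = 1" "(\<Sum>b<m2. q b) = 1"
    and D: "\<And>i. i < m1 * m2 \<Longrightarrow> D i = prod_dist m1 p q i" and i: "i < m1 * m2"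
  shows "ada_step (m1 * m2) (N1 + N2) (prod_mat m1 N1 M1 M2) D i
    = (if top_edge m2 N2 M2 q \<le> top_edge m1 N1 M1 p then prod_dist m1 (ada_step m1 N1 M1 p) q i
       else prod_dist m1 p (ada_step m2 N2 M2 q) i)"
proof -
  note marginals = marginals_prod_dist[OF D total]
  have "ada_step (m1 * m2) (N1 + N2) (prod_mat m1 N1 M1 M2) D i
    = prod_dist m1 p q i / (1 + max (top_edge m1 N1 M1 p) (top_edge m2 N2 M2 q) * prod_mat m1 N1 M1 M2 i
        (if top_edge m2 N2 M2 q \<le> top_edge m1 N1 M1 p then sel_col m1 N1 M1 p
         else N1 + sel_col m2 N2 M2 q))"
    using N by (simp add: ada_step_eq sel_col_prod_mat top_edge_prod_mat D[OF i] marginals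
        cong: top_edge_cong sel_col_cong)
  then show ?thesis
    using N sel_col_less[OF N(1), of m1 M1 p] by (auto simp: prod_mat_def prod_dist_def ada_step_eq)
qed

primrec merge :: "(nat \<Rightarrow> real) \<Rightarrow> (nat \<Rightarrow> real) \<Rightarrow> nat \<Rightarrow> nat \<times> nat" where
  "merge a b 0 = (0, 0)"
| "merge a b (Suc t) = (let (k, l) = merge a b t in if b l \<le> a k then (Suc k, l) else (k, Suc l))"

lemma ada_iter_prod_mat:
  fixes m1 N1 M1 m2 N2 M2
  defines "a \<equiv> \<lambda>k. top_edge m1 N1 M1 (ada_iter m1 N1 M1 k)"
    and "b \<equiv> \<lambda>k. top_edge m2 N2 M2 (ada_iter m2 N2 M2 k)"
  assumes reg: "regular_run m1 N1 M1" "regular_run m2 N2 M2"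
  assumes "i < m1 * m2"
  shows "ada_iter (m1 * m2) (N1 + N2) (prod_mat m1 N1 M1 M2) t i
    = prod_dist m1 (ada_iter m1 N1 M1 (fst (merge a b t))) (ada_iter m2 N2 M2 (snd (merge a b t))) i"
  using \<open>i < m1 * m2\<close>
proof (induction t arbitrary: i)
  case 0
  then show ?case by (simp add: prod_dist_def)
next
  case (Suc t)
  have "0 < N1" "0 < N2" using reg by (auto simp: regular_run_def)
  note step = ada_step_prod_mat[OF this sum_ada_iter[OF reg(1)] sum_ada_iter[OF reg(2)] Suc.IH Suc.prems]
  show ?case by (simp add: step a_def b_def Let_def split_beta)
qed

section \<open>Interleavings of two edge sequences\<close>

definition interleaving ::
  "(nat \<Rightarrow> real) \<Rightarrow> (nat \<Rightarrow> real) \<Rightarrow> (nat \<Rightarrow> nat) \<Rightarrow> (nat \<Rightarrow> nat) \<Rightarrow> bool" where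
  "interleaving a b x y \<longleftrightarrow> x 0 = 0 \<and> y 0 = 0 \<and>
     (\<forall>s. x (Suc s) = Suc (x s) \<and> y (Suc s) = y s \<and> b (y s) \<le> a (x s) \<or>
          x (Suc s) = x s \<and> y (Suc s) = Suc (y s) \<and> a (x s) \<le> b (y s))"

lemma interleaving_swap: "interleaving a b x y \<Longrightarrow> interleaving b a y x"
  by (auto simp: interleaving_def)

lemma interleaving_merge: "interleaving a b (\<lambda>s. fst (merge a b s)) (\<lambda>s. snd (merge a b s))"
  by (auto simp: interleaving_def Let_def split: prod.splits)

lemma interleaving_Suc:
  assumes "interleaving a b x y"
  obtains "x (Suc s) = Suc (x s)" "y (Suc s) = y s" "b (y s) \<le> a (x s)"
    | "x (Suc s) = x s" "y (Suc s) = Suc (y s)" "a (x s) \<le> b (y s)"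
  using assms unfolding interleaving_def by blast

lemma interleaving_add:
  assumes "interleaving a b x y"
  shows "x s + y s = s"
proof (induction s)
  case 0
  then show ?case using assms by (simp add: interleaving_def)
next
  case (Suc s)
  then show ?case by (cases rule: interleaving_Suc[OF assms, of s]) auto
qed

text \<open>The maximal edges along a run that approaches a cycle of length \<open>p\<close> whose minimal edge \<open>\<alpha>\<close> is
  attained once per turn, with an excess of exact order \<open>\<kappa> ^ (-c)\<close> in turn \<open>c\<close>.\<close>

definition bursts :: "real \<Rightarrow> real \<Rightarrow> nat \<Rightarrow> (nat \<Rightarrow> real) \<Rightarrow> bool" where
  "bursts \<alpha> \<kappa> p e \<longleftrightarrow> 0 < p \<and> 1 < \<kappa> \<and>
     (\<exists>\<eta>>0. \<forall>k. \<not> p dvd k \<longrightarrow> \<alpha> + \<eta> \<le> e k) \<and>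
     (\<exists>A>0. \<exists>B. \<forall>c. A \<le> \<kappa> ^ c * (e (p * c) - \<alpha>) \<and> \<kappa> ^ c * (e (p * c) - \<alpha>) \<le> B)"

lemma bursts_gt:
  assumes "bursts \<alpha> \<kappa> p e"
  shows "\<alpha> < e k"
proof (cases "p dvd k")
  case True
  then obtain c where c: "k = p * c" ..
  obtain A where "0 < A" "A \<le> \<kappa> ^ c * (e (p * c) - \<alpha>)"
    using assms unfolding bursts_def by blast
  then have "0 < \<kappa> ^ c * (e (p * c) - \<alpha>)" by simp
  moreover have "0 < \<kappa> ^ c" using assms by (simp add: bursts_def)
  ultimately show ?thesis unfolding c zero_less_mult_iff by linarith
next
  case False
  then show ?thesis using assms by (force simp: bursts_def)
qed

lemma bursts_tendsto:
  assumes "bursts \<alpha> \<kappa> p e"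
  shows "(\<lambda>c. e (p * c)) \<longlonglongrightarrow> \<alpha>"
proof -
  obtain B where B: "\<And>c. \<kappa> ^ c * (e (p * c) - \<alpha>) \<le> B"
    using assms unfolding bursts_def by blast
  have \<kappa>: "1 < \<kappa>" using assms by (simp add: bursts_def)
  have "(\<lambda>c. e (p * c) - \<alpha>) \<longlonglongrightarrow> 0"
  proof (rule tendsto_sandwich[OF _ _ tendsto_const])
    show "\<forall>\<^sub>F c in sequentially. 0 \<le> e (p * c) - \<alpha>"
      using bursts_gt[OF assms] by (simp add: less_imp_le)
    show "\<forall>\<^sub>F c in sequentially. e (p * c) - \<alpha> \<le> B * (1 / \<kappa>) ^ c"
      using B \<kappa> by (simp add: power_one_over field_simps)
    show "(\<lambda>c. B * (1 / \<kappa>) ^ c) \<longlonglongrightarrow> 0"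
      using \<kappa> by (intro tendsto_mult_right_zero LIMSEQ_power_zero) simp
  qed
  then show ?thesis by (rule LIM_zero_cancel)
qed

lemma interleaving_leave:
  assumes xy: "interleaving a b x y" and a: "bursts \<alpha> \<kappa> p a" and b: "bursts \<alpha> \<kappa>' p' b"
    and s: "x s = k"
  obtains t where "x t = k" "x (Suc t) = Suc k"
proof (rule ccontr)
  assume stuck: "\<not> thesis"
  have wait: "x (s + n) = k" for n
  proof (induction n)
    case (Suc n)
    then show ?case
      using stuck that by (cases rule: interleaving_Suc[OF xy, of "s + n"]) auto
  qed (simp add: s)
  have y: "y (s + n) = s + n - k" for n
    using interleaving_add[OF xy, of "s + n"] wait[of n] by simp
  have "a k \<le> b l" if "s - k \<le> l" "k \<le> s" for l
  proof -
    have "y (k + l) = l" "x (k + l) = k" "x (Suc (k + l)) = k"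
      using that y[of "k + l - s"] wait[of "k + l - s"] wait[of "Suc (k + l) - s"] by auto
    then show ?thesis by (cases rule: interleaving_Suc[OF xy, of "k + l"]) auto
  qed
  moreover have "k \<le> s" using interleaving_add[OF xy, of s] s by simp
  ultimately have wait_le: "a k \<le> b l" if "s \<le> l" for l
    using that by simp
  have "\<forall>\<^sub>F c in sequentially. b (p' * c) < a k \<and> s \<le> c"
    using order_tendstoD(2)[OF bursts_tendsto[OF b] bursts_gt[OF a]] eventually_ge_at_top
    by (rule eventually_conj)
  then obtain c where c: "b (p' * c) < a k" "s \<le> c"
    unfolding eventually_sequentially by blast
  then have "s \<le> p' * c" using b by (auto simp: bursts_def intro: order_trans)
  then show False using wait_le[of "p' * c"] c(1) by simp
qed

lemma interleaving_reach:
  assumes "interleaving a b x y" "bursts \<alpha> \<kappa> p a" "bursts \<alpha> \<kappa>' p' b"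
  obtains t where "x t = k" "x (Suc t) = Suc k"
proof -
  have "\<exists>s. x s = k"
  proof (induction k)
    case 0
    then show ?case using assms(1) by (auto simp: interleaving_def)
  next
    case (Suc k)
    then show ?case using interleaving_leave[OF assms] by metis
  qed
  then show ?thesis using interleaving_leave[OF assms] that by metis
qed

lemma interleaving_at_burst:
  assumes xy: "interleaving a b x y" and a: "bursts \<alpha> \<kappa> p a" and b: "bursts \<alpha> \<kappa>' p' b"
  shows "\<forall>\<^sub>F c in sequentially. \<exists>s d. x s = p * c \<and> y s = p' * d \<and> b (p' * d) \<le> a (p * c)"
proof -
  obtain \<eta> where \<eta>: "0 < \<eta>" "\<And>k. \<not> p' dvd k \<Longrightarrow> \<alpha> + \<eta> \<le> b k"
    using b unfolding bursts_def by blast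
  have "\<forall>\<^sub>F c in sequentially. a (p * c) < \<alpha> + \<eta>"
    using \<eta>(1) by (intro order_tendstoD(2)[OF bursts_tendsto[OF a]]) simp
  then show ?thesis
  proof eventually_elim
    case (elim c)
    obtain s where s: "x s = p * c" "x (Suc s) = Suc (p * c)"
      using xy a b by (rule interleaving_reach)
    then have le: "b (y s) \<le> a (p * c)"
      by (cases rule: interleaving_Suc[OF xy, of s]) auto
    then have "p' dvd y s" using \<eta>(2)[of "y s"] elim by fastforce
    then obtain d where "y s = p' * d" ..
    then show ?case using s(1) le by auto
  qed
qed

lemma bursts_le_imp_turns_le:
  assumes a: "bursts \<alpha> \<kappa> p a" and b: "bursts \<alpha> \<kappa>' p' b"
  obtains L where "\<And>c d. b (p' * d) \<le> a (p * c) \<Longrightarrow> c * ln \<kappa> \<le> d * ln \<kappa>' + L"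
proof -
  obtain B where B: "\<And>c. \<kappa> ^ c * (a (p * c) - \<alpha>) \<le> B"
    using a unfolding bursts_def by blast
  obtain A where A: "0 < A" "\<And>d. A \<le> \<kappa>' ^ d * (b (p' * d) - \<alpha>)"
    using b unfolding bursts_def by blast
  have \<kappa>: "1 < \<kappa>" "1 < \<kappa>'" using a b by (auto simp: bursts_def)
  have "0 < \<kappa> ^ 0 * (a (p * 0) - \<alpha>)" using bursts_gt[OF a, of 0] by simp
  then have "0 < B" using B by (rule less_le_trans)
  have "c * ln \<kappa> \<le> d * ln \<kappa>' + ln (B / A)" if le: "b (p' * d) \<le> a (p * c)" for c d
  proof -
    have "A * \<kappa> ^ c \<le> \<kappa>' ^ d * (b (p' * d) - \<alpha>) * \<kappa> ^ c"
      using A(2)[of d] \<kappa> by (intro mult_right_mono) auto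
    also have "\<dots> \<le> \<kappa>' ^ d * (\<kappa> ^ c * (a (p * c) - \<alpha>))"
      using le \<kappa> by (simp add: mult_ac mult_left_mono)
    also have "\<dots> \<le> \<kappa>' ^ d * B"
      using B[of c] \<kappa> by (intro mult_left_mono) auto
    finally have "\<kappa> ^ c \<le> \<kappa>' ^ d * (B / A)" using A(1) by (simp add: field_simps)
    then have "ln (\<kappa> ^ c) \<le> ln (\<kappa>' ^ d * (B / A))"
      using \<kappa> A(1) \<open>0 < B\<close> by (subst ln_le_cancel_iff) auto
    then show ?thesis
      using \<kappa> A(1) \<open>0 < B\<close> by (simp add: ln_mult ln_realpow del: times_divide_eq_right)
  qed
  then show ?thesis by (rule that)
qed

lemma eventually_linear_le_imp_nonpos:
  assumes "\<forall>\<^sub>F c in sequentially. \<beta> * real c \<le> L"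
  shows "\<beta> \<le> 0"
proof (rule ccontr)
  assume "\<not> \<beta> \<le> 0"
  then have "filterlim (\<lambda>c. \<beta> * real c) at_top sequentially"
    by (intro filterlim_tendsto_pos_mult_at_top[OF tendsto_const] filterlim_real_sequentially) simp
  then have "\<forall>\<^sub>F c in sequentially. L < \<beta> * real c"
    by (simp add: filterlim_at_top_dense)
  with assms have "\<forall>\<^sub>F c :: nat in sequentially. False"
    by eventually_elim simp
  then show False by simp
qed

lemma interleaving_rate_le:
  assumes xy: "interleaving a b x y" and a: "bursts \<alpha> \<kappa> p a" and b: "bursts \<alpha> \<kappa>' p' b"
    and balanced: "\<And>s. \<bar>v * real (x s) - u * real (y s)\<bar> \<le> C" and u: "0 < u"
  shows "u * p' * ln \<kappa> \<le> v * p * ln \<kappa>'"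
proof -
  obtain L where L: "\<And>c d. b (p' * d) \<le> a (p * c) \<Longrightarrow> c * ln \<kappa> \<le> d * ln \<kappa>' + L"
    using bursts_le_imp_turns_le[OF a b] by blast
  have "1 < \<kappa>'" using b by (simp add: bursts_def)
  have "\<forall>\<^sub>F c in sequentially.
      (u * p' * ln \<kappa> - v * p * ln \<kappa>') * real c \<le> C * ln \<kappa>' + u * p' * L"
    using interleaving_at_burst[OF xy a b]
  proof eventually_elim
    case (elim c)
    then obtain s d where s: "x s = p * c" "y s = p' * d" "b (p' * d) \<le> a (p * c)" by blast
    have "u * p' * (c * ln \<kappa>) \<le> u * p' * (d * ln \<kappa>' + L)"
      using L[OF s(3)] u by (intro mult_left_mono) auto
    moreover have "u * (p' * d) * ln \<kappa>' \<le> (v * (p * c) + C) * ln \<kappa>'"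
      using balanced[of s] \<open>1 < \<kappa>'\<close> by (intro mult_right_mono) (auto simp: s abs_le_iff)
    ultimately show ?case by (simp add: algebra_simps)
  qed
  then have "u * p' * ln \<kappa> - v * p * ln \<kappa>' \<le> 0" by (rule eventually_linear_le_imp_nonpos)
  then show ?thesis by simp
qed

lemma eventually_periodic_imp_bounded:
  fixes g :: "nat \<Rightarrow> real"
  assumes "\<And>s. s \<ge> s0 \<Longrightarrow> g (s + l) = g s" "0 < l"
  obtains C where "\<And>s. \<bar>g s\<bar> \<le> C"
proof
  show "\<bar>g s\<bar> \<le> Max ((\<lambda>s. \<bar>g s\<bar>) ` {..s0 + l})" (is "_ \<le> ?C") for s
  proof (induction s rule: less_induct)
    case (less s)
    show ?case
    proof (cases "s \<le> s0 + l")
      case True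
      then show ?thesis by (intro Max_ge) auto
    next
      case False
      then have "g s = g (s - l)" using assms(1)[of "s - l"] by simp
      then show ?thesis using less.IH[of "s - l"] False assms(2) by simp
    qed
  qed
qed

lemma interleaving_period_pos:
  assumes "interleaving a b x y" "bursts \<alpha> \<kappa> p a" "bursts \<alpha> \<kappa>' p' b"
    and period: "\<And>s. s \<ge> s0 \<Longrightarrow> x (s + l) = x s + u" and l: "0 < l"
  shows "0 < u"
proof (rule ccontr)
  assume "\<not> 0 < u"
  then obtain C where C: "\<And>s. \<bar>real (x s)\<bar> \<le> C"
    using eventually_periodic_imp_bounded[of s0 "\<lambda>s. real (x s)" l] period l by auto
  obtain s where "x s = nat \<lceil>C\<rceil> + 1" using assms(1,2,3) by (rule interleaving_reach)
  then show False using C[of s] by linarith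
qed

lemma periodic_interleaving_shift:
  assumes xy: "interleaving a b x y"
    and periodic: "\<And>s. s \<ge> s0 \<Longrightarrow> x (Suc (s + l)) = Suc (x (s + l)) \<longleftrightarrow> x (Suc s) = Suc (x s)"
  obtains u v where "\<And>s. s \<ge> s0 \<Longrightarrow> x (s + l) = x s + u" "\<And>s. s \<ge> s0 \<Longrightarrow> y (s + l) = y s + v"
proof -
  define u v where "u = x (s0 + l) - x s0" and "v = l - u"
  note total = interleaving_add[OF xy]
  have Suc_x: "x (Suc s) = (if x (Suc s) = Suc (x s) then Suc (x s) else x s)" for s
    by (cases rule: interleaving_Suc[OF xy, of s]) auto
  have "x s \<le> x (Suc s) \<and> y s \<le> y (Suc s)" for s
    by (cases rule: interleaving_Suc[OF xy, of s]) auto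
  then have mono: "incseq x" "incseq y" by (auto intro!: incseq_SucI)
  have x: "x (s + l) = x s + u" if "s \<ge> s0" for s
    using that
  proof (induction s rule: dec_induct)
    case base
    then show ?case using incseqD[OF mono(1), of s0 "s0 + l"] by (simp add: u_def)
  next
    case (step s)
    then show ?case using periodic[of s] Suc_x[of s] Suc_x[of "s + l"] by (auto split: if_splits)
  qed
  have "u \<le> l"
    using x[of s0] total[of s0] total[of "s0 + l"] incseqD[OF mono(2), of s0 "s0 + l"] by simp
  then have y: "y (s + l) = y s + v" if "s \<ge> s0" for s
    using x[OF that] total[of s] total[of "s + l"] by (simp add: v_def)
  show ?thesis using x y by (rule that)
qed

lemma periodic_interleaving_imp_commensurable:
  assumes xy: "interleaving a b x y" and a: "bursts \<alpha> \<kappa> p a" and b: "bursts \<alpha> \<kappa>' p' b"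
    and l: "0 < l" and periodic: "\<forall>\<^sub>F s in sequentially.
      x (Suc (s + l)) = Suc (x (s + l)) \<longleftrightarrow> x (Suc s) = Suc (x s)"
  shows "\<exists>i>0. \<exists>j>0. \<kappa> ^ i = \<kappa>' ^ j"
proof -
  obtain s0 u v where x: "\<And>s. s \<ge> s0 \<Longrightarrow> x (s + l) = x s + u"
    and y: "\<And>s. s \<ge> s0 \<Longrightarrow> y (s + l) = y s + v"
    using periodic periodic_interleaving_shift[OF xy] unfolding eventually_sequentially by metis
  have u: "0 < u" using xy a b x l by (rule interleaving_period_pos)
  have v: "0 < v" using interleaving_swap[OF xy] b a y l by (rule interleaving_period_pos)
  obtain C where C: "\<And>s. \<bar>real v * real (x s) - real u * real (y s)\<bar> \<le> C"
    by (rule eventually_periodic_imp_bounded[of s0 "\<lambda>s. real v * real (x s) - real u * real (y s)" l])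
       (auto simp: x y l algebra_simps)
  have "real u * p' * ln \<kappa> \<le> real v * p * ln \<kappa>'"
    using C u by (intro interleaving_rate_le[OF xy a b]) auto
  moreover have "real v * p * ln \<kappa>' \<le> real u * p' * ln \<kappa>"
    using C v by (intro interleaving_rate_le[OF interleaving_swap[OF xy] b a])
      (auto simp: abs_minus_commute)
  moreover have "1 < \<kappa>" "1 < \<kappa>'" "0 < p" "0 < p'" using a b by (auto simp: bursts_def)
  ultimately have "ln (\<kappa> ^ (u * p')) = ln (\<kappa>' ^ (v * p))" by (simp add: ln_realpow)
  with \<open>1 < \<kappa>\<close> \<open>1 < \<kappa>'\<close> have "\<kappa> ^ (u * p') = \<kappa>' ^ (v * p)"
    by (subst (asm) ln_inj_iff) auto
  moreover have "0 < u * p'" "0 < v * p" using u v \<open>0 < p\<close> \<open>0 < p'\<close> by auto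
  ultimately show ?thesis by blast
qed

section \<open>Cycles of a product run\<close>

lemma LIMSEQ_residue_classes:
  assumes l: "0 < l" and lim: "\<And>b. b < l \<Longrightarrow> (\<lambda>k. f (k * l + b)) \<longlonglongrightarrow> L"
  shows "f \<longlonglongrightarrow> L"
proof (rule topological_tendstoI)
  fix S assume "open S" "L \<in> S"
  then have "\<forall>\<^sub>F k in sequentially. \<forall>b\<in>{..<l}. f (k * l + b) \<in> S"
    using lim by (intro eventually_ball_finite) (auto dest: topological_tendstoD)
  then obtain K where K: "\<And>k b. K \<le> k \<Longrightarrow> b < l \<Longrightarrow> f (k * l + b) \<in> S"
    by (auto simp: eventually_sequentially)
  have "f s \<in> S" if "K * l \<le> s" for s
    using K[of "s div l" "s mod l"] l div_le_mono[OF that, of l] by simp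
  then show "\<forall>\<^sub>F s in sequentially. f s \<in> S"
    by (auto simp: eventually_sequentially)
qed

lemma conv_cycle_diff_tendsto:
  assumes "conv_cycle m D l" "i < m"
  shows "(\<lambda>s. D (s + l) i - D s i) \<longlonglongrightarrow> 0"
proof (rule LIMSEQ_residue_classes)
  show "0 < l" using assms by (simp add: conv_cycle_def)
  fix b assume "b < l"
  then obtain d where d: "(\<lambda>k. D (k * l + b) i) \<longlonglongrightarrow> d"
    using assms unfolding conv_cycle_def by blast
  have "(\<lambda>k. D (Suc k * l + b) i - D (k * l + b) i) \<longlonglongrightarrow> d - d"
    by (rule tendsto_diff[OF LIMSEQ_Suc[OF d] d])
  then show "(\<lambda>k. D (k * l + b + l) i - D (k * l + b) i) \<longlonglongrightarrow> 0"
    by (simp add: algebra_simps)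
qed

lemma conv_cycle_edge_diff_tendsto:
  assumes "conv_cycle m (adaD m N M) l"
  shows "(\<lambda>s. edge m M (ada_iter m N M (s + l)) j - edge m M (ada_iter m N M s) j) \<longlonglongrightarrow> 0"
proof -
  have "(\<lambda>s. ada_iter m N M (s + l) i - ada_iter m N M s i) \<longlonglongrightarrow> 0" if "i < m" for i
    using LIMSEQ_Suc[OF conv_cycle_diff_tendsto[OF assms that]] by (simp add: adaD_def)
  then have "(\<lambda>s. \<Sum>i<m. (ada_iter m N M (s + l) i - ada_iter m N M s i) * M i j) \<longlonglongrightarrow> 0"
    by (intro tendsto_null_sum tendsto_mult_left_zero) auto
  then show ?thesis by (simp add: edge_def sum_subtractf left_diff_distrib)
qed

lemma edge_ada_iter_prod_mat_left:
  fixes m1 N1 M1 m2 N2 M2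
  defines "a \<equiv> \<lambda>k. top_edge m1 N1 M1 (ada_iter m1 N1 M1 k)"
    and "b \<equiv> \<lambda>k. top_edge m2 N2 M2 (ada_iter m2 N2 M2 k)"
  assumes reg: "regular_run m1 N1 M1" "regular_run m2 N2 M2" and j: "j < N1"
  shows "edge (m1 * m2) (prod_mat m1 N1 M1 M2)
      (ada_iter (m1 * m2) (N1 + N2) (prod_mat m1 N1 M1 M2) t) j
    = edge m1 M1 (ada_iter m1 N1 M1 (fst (merge a b t))) j"
  unfolding edge_prod_mat_left[OF j] a_def b_def
  using marginals_prod_dist(1)[OF ada_iter_prod_mat[OF reg] sum_ada_iter[OF reg(1)] sum_ada_iter[OF reg(2)]]
  by (intro fun_cong[OF edge_cong])

lemma ada_iter_Suc_edge_drop: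
  assumes reg: "regular_run m N M" and "\<alpha> < top_edge m N M (ada_iter m N M k)"
  shows "\<exists>j<N. edge m M (ada_iter m N M (Suc k)) j - edge m M (ada_iter m N M k) j < - \<alpha>"
proof (intro exI conjI)
  let ?j = "sel_col m N M (ada_iter m N M k)"
  have N: "0 < N" using reg by (simp add: regular_run_def)
  then show "?j < N" by (rule sel_col_less)
  have "edge m M (ada_step m N M (ada_iter m N M k)) ?j = 0"
    using reg sum_ada_iter[OF reg] by (intro edge_ada_step_sel_col) (auto simp: regular_run_def)
  then show "edge m M (ada_iter m N M (Suc k)) ?j - edge m M (ada_iter m N M k) ?j < - \<alpha>"
    using assms(2) by (simp add: edge_sel_col[OF N])
qed

text \<open>A move of the first factor lowers one of its edges by more than \<open>\<alpha>\<close>; otherwise none of them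
  changes. So the moves can be read off the increments of the edges.\<close>

lemma conv_cycle_prod_mat_imp_periodic:
  fixes m1 N1 M1 m2 N2 M2
  defines "a \<equiv> \<lambda>k. top_edge m1 N1 M1 (ada_iter m1 N1 M1 k)"
    and "b \<equiv> \<lambda>k. top_edge m2 N2 M2 (ada_iter m2 N2 M2 k)"
  defines "x \<equiv> \<lambda>s. fst (merge a b s)"
  assumes reg: "regular_run m1 N1 M1" "regular_run m2 N2 M2"
    and \<alpha>: "0 < \<alpha>" "\<And>k. \<alpha> < a k"
    and conv: "conv_cycle (m1 * m2) (adaD (m1 * m2) (N1 + N2) (prod_mat m1 N1 M1 M2)) l"
  shows "\<forall>\<^sub>F s in sequentially. x (Suc (s + l)) = Suc (x (s + l)) \<longleftrightarrow> x (Suc s) = Suc (x s)"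
proof -
  define e where "e s = edge m1 M1 (ada_iter m1 N1 M1 (x s))" for s
  define \<Delta> where "\<Delta> s j = e (Suc s) j - e s j" for s j
  have move: "\<exists>j<N1. \<Delta> s j < - \<alpha>" if "x (Suc s) = Suc (x s)" for s
    using ada_iter_Suc_edge_drop[OF reg(1)] \<alpha>(2)[of "x s"] by (simp add: \<Delta>_def e_def that a_def)
  have stay: "\<Delta> s j = 0" if "x (Suc s) \<noteq> Suc (x s)" for s j
    using that by (auto simp: \<Delta>_def e_def x_def Let_def split: prod.splits if_splits)
  have "\<forall>\<^sub>F s in sequentially. \<bar>\<Delta> (s + l) j - \<Delta> s j\<bar> < \<alpha>" if "j < N1" for j
  proof -
    have diff: "(\<lambda>s. e (s + l) j - e s j) \<longlonglongrightarrow> 0"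
      using conv_cycle_edge_diff_tendsto[OF conv, of j]
      by (simp add: edge_ada_iter_prod_mat_left[OF reg that] e_def x_def a_def b_def)
    have "(\<lambda>s. \<Delta> (s + l) j - \<Delta> s j) \<longlonglongrightarrow> 0"
      using tendsto_diff[OF LIMSEQ_Suc[OF diff] diff] by (simp add: \<Delta>_def algebra_simps)
    from tendstoD[OF this \<alpha>(1)] show ?thesis by (simp add: dist_real_def)
  qed
  then have "\<forall>\<^sub>F s in sequentially. \<forall>j\<in>{..<N1}. \<bar>\<Delta> (s + l) j - \<Delta> s j\<bar> < \<alpha>"
    by (intro eventually_ball_finite) auto
  then show ?thesis
  proof eventually_elim
    case (elim s)
    have close: "\<bar>\<Delta> (s + l) j - \<Delta> s j\<bar> < \<alpha>" if "j < N1" for j using elim that by simp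
    show ?case
    proof
      assume "x (Suc (s + l)) = Suc (x (s + l))"
      then obtain j where "j < N1" "\<Delta> (s + l) j < - \<alpha>" using move by blast
      then show "x (Suc s) = Suc (x s)" using stay[of s j] close[of j] by force
    next
      assume "x (Suc s) = Suc (x s)"
      then obtain j where "j < N1" "\<Delta> s j < - \<alpha>" using move by blast
      then show "x (Suc (s + l)) = Suc (x (s + l))" using stay[of "s + l" j] close[of j] by force
    qed
  qed
qed

theorem prod_mat_not_conv_finite_cycle:
  assumes reg: "regular_run m1 N1 M1" "regular_run m2 N2 M2" and \<alpha>: "0 < \<alpha>"
    and bursts: "bursts \<alpha> \<kappa>1 p1 (\<lambda>k. top_edge m1 N1 M1 (ada_iter m1 N1 M1 k))"
      "bursts \<alpha> \<kappa>2 p2 (\<lambda>k. top_edge m2 N2 M2 (ada_iter m2 N2 M2 k))"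
    and independent: "\<And>i j. 0 < i \<Longrightarrow> 0 < j \<Longrightarrow> \<kappa>1 ^ i \<noteq> \<kappa>2 ^ j"
  shows "\<not> conv_finite_cycle (m1 * m2) (adaD (m1 * m2) (N1 + N2) (prod_mat m1 N1 M1 M2))"
proof
  assume "conv_finite_cycle (m1 * m2) (adaD (m1 * m2) (N1 + N2) (prod_mat m1 N1 M1 M2))"
  then obtain l where l: "conv_cycle (m1 * m2) (adaD (m1 * m2) (N1 + N2) (prod_mat m1 N1 M1 M2)) l"
    by (auto simp: conv_finite_cycle_def)
  then have "0 < l" by (simp add: conv_cycle_def)
  then have "\<exists>i>0. \<exists>j>0. \<kappa>1 ^ i = \<kappa>2 ^ j"
    using conv_cycle_prod_mat_imp_periodic[OF reg \<alpha> bursts_gt[OF bursts(1)] l]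
    by (rule periodic_interleaving_imp_commensurable[OF interleaving_merge bursts])
  then show False using independent by blast
qed

section \<open>AdaBoost on rows with two negative entries\<close>

text \<open>A row with entries \<open>-1\<close> in the columns \<open>a\<close> and \<open>b\<close> has weight proportional to \<open>c a b * v a * v b\<close>.
  Columns are the coordinates below \<open>n\<close>; coordinate \<open>n\<close> is a dummy that is never selected, so that the
  pair \<open>{a, n}\<close> stands for a row whose only entry \<open>-1\<close> is in column \<open>a\<close>.\<close>

definition lin_form :: "nat \<Rightarrow> (nat \<Rightarrow> nat \<Rightarrow> nat) \<Rightarrow> (nat \<Rightarrow> real) \<Rightarrow> nat \<Rightarrow> real" where
  "lin_form n c v j = (\<Sum>k\<le>n. real (c j k) * v k)"

definition polar_form :: "nat \<Rightarrow> (nat \<Rightarrow> nat \<Rightarrow> nat) \<Rightarrow> (nat \<Rightarrow> real) \<Rightarrow> (nat \<Rightarrow> real) \<Rightarrow> real" where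
  "polar_form n c u v = (\<Sum>k\<le>n. lin_form n c u k * v k)"

definition quad_form :: "nat \<Rightarrow> (nat \<Rightarrow> nat \<Rightarrow> nat) \<Rightarrow> (nat \<Rightarrow> real) \<Rightarrow> real" where
  "quad_form n c v = polar_form n c v v"

definition quad_edge :: "nat \<Rightarrow> (nat \<Rightarrow> nat \<Rightarrow> nat) \<Rightarrow> (nat \<Rightarrow> real) \<Rightarrow> nat \<Rightarrow> real" where
  "quad_edge n c v j = 1 - 4 * (v j * lin_form n c v j) / quad_form n c v"

definition quad_step :: "nat \<Rightarrow> (nat \<Rightarrow> nat \<Rightarrow> nat) \<Rightarrow> nat \<Rightarrow> (nat \<Rightarrow> real) \<Rightarrow> nat \<Rightarrow> real" where
  "quad_step n c j v = v(j := quad_form n c v / (2 * lin_form n c v j) - v j)"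

definition selects :: "nat \<Rightarrow> (nat \<Rightarrow> nat \<Rightarrow> nat) \<Rightarrow> (nat \<Rightarrow> real) \<Rightarrow> nat \<Rightarrow> bool" where
  "selects n c v j \<longleftrightarrow> (\<forall>k<n. 0 < v k) \<and> 0 < quad_form n c v \<and> 0 < lin_form n c v j \<and>
     (\<forall>k<n. k \<noteq> j \<longrightarrow> v j * lin_form n c v j < v k * lin_form n c v k)"

lemma lin_form_add_scaled: "lin_form n c (\<lambda>k. u k + h * v k) j = lin_form n c u j + h * lin_form n c v j"
  by (simp add: lin_form_def sum.distrib sum_distrib_left algebra_simps)

lemma lin_form_scale: "lin_form n c (\<lambda>k. a * v k) j = a * lin_form n c v j"
  by (simp add: lin_form_def sum_distrib_left algebra_simps)

lemma quad_form_scale: "quad_form n c (\<lambda>k. a * v k) = a\<^sup>2 * quad_form n c v"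
  by (simp add: quad_form_def polar_form_def lin_form_scale sum_distrib_left power2_eq_square algebra_simps)

locale pair_weights =
  fixes n :: nat and c :: "nat \<Rightarrow> nat \<Rightarrow> nat"
  assumes weight_commute: "\<And>a b. a \<le> n \<Longrightarrow> b \<le> n \<Longrightarrow> c a b = c b a"
    and weight_diag: "\<And>a. a \<le> n \<Longrightarrow> c a a = 0"
begin

abbreviation "L \<equiv> lin_form n c"
abbreviation "Q \<equiv> quad_form n c"

lemma polar_form_commute: "polar_form n c u v = polar_form n c v u"
proof -
  have "polar_form n c u v = (\<Sum>k\<le>n. \<Sum>j\<le>n. real (c k j) * u j * v k)"
    by (simp add: polar_form_def lin_form_def sum_distrib_right)
  also have "\<dots> = (\<Sum>j\<le>n. \<Sum>k\<le>n. real (c k j) * u j * v k)" by (rule sum.swap)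
  also have "\<dots> = (\<Sum>j\<le>n. \<Sum>k\<le>n. real (c j k) * v k * u j)"
    by (intro sum.cong) (auto simp: weight_commute)
  also have "\<dots> = polar_form n c v u"
    by (simp add: polar_form_def lin_form_def sum_distrib_right)
  finally show ?thesis .
qed

lemma quad_form_add_scaled:
  "Q (\<lambda>k. u k + h * v k) = Q u + 2 * h * polar_form n c u v + h\<^sup>2 * Q v"
proof -
  have "Q (\<lambda>k. u k + h * v k)
      = Q u + h * polar_form n c u v + h * polar_form n c v u + h\<^sup>2 * Q v"
    by (simp add: quad_form_def polar_form_def lin_form_add_scaled sum.distrib sum_distrib_left
        power2_eq_square algebra_simps)
  then show ?thesis by (simp add: polar_form_commute[of v u])
qed

lemma quad_form_fun_upd:
  assumes "j \<le> n"
  shows "Q (v(j := x)) = Q v + 2 * (x - v j) * L v j"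
proof -
  define \<delta> :: "nat \<Rightarrow> real" where "\<delta> k = (if k = j then 1 else 0)" for k
  have "v(j := x) = (\<lambda>k. v k + (x - v j) * \<delta> k)" by (auto simp: \<delta>_def)
  moreover have polar: "polar_form n c u \<delta> = L u j" for u
    using assms by (simp add: polar_form_def \<delta>_def mult_delta_right)
  moreover have "Q \<delta> = 0"
    using assms weight_diag by (simp add: quad_form_def polar lin_form_def \<delta>_def mult_delta_right)
  ultimately show ?thesis by (simp add: quad_form_add_scaled)
qed

end

subsection \<open>Pair weights\<close>

definition pair_weight :: "nat \<Rightarrow> (nat \<Rightarrow> nat \<Rightarrow> nat) \<Rightarrow> (nat \<Rightarrow> real) \<Rightarrow> nat \<times> nat \<Rightarrow> real" where
  "pair_weight n c v = (\<lambda>(a, b). real (c a b) * v a * v b / quad_form n c v)"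

definition pair_sign :: "nat \<times> nat \<Rightarrow> nat \<Rightarrow> real" where
  "pair_sign = (\<lambda>(a, b) j. if j = a \<or> j = b then -1 else 1)"

definition pair_multiplicity :: "(nat \<Rightarrow> nat \<Rightarrow> nat) \<Rightarrow> (nat \<Rightarrow> nat) \<Rightarrow> nat \<times> nat \<Rightarrow> nat" where
  "pair_multiplicity c w = (\<lambda>(a, b). c a b * w a * w b)"

lemma pair_weight_scale: "s \<noteq> 0 \<Longrightarrow> pair_weight n c (\<lambda>k. s * v k) = pair_weight n c v"
  by (auto simp: pair_weight_def quad_form_scale power2_eq_square fun_eq_iff)

lemma sum_pair_products: "(\<Sum>(a, b)\<in>{..n} \<times> {..n}. real (c a b) * v a * v b) = quad_form n c v"
  by (simp add: quad_form_def polar_form_def lin_form_def sum_distrib_left sum_distrib_right mult_ac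
      flip: sum.cartesian_product)

lemma sum_pair_weight:
  "quad_form n c v \<noteq> 0 \<Longrightarrow> (\<Sum>x\<in>{..n} \<times> {..n}. pair_weight n c v x) = 1"
  using sum_pair_products[of c v n]
  by (simp add: pair_weight_def split_beta flip: sum_divide_distrib)

lemma sum_pair_sign_ge: "real n - 4 \<le> (\<Sum>j<n. pair_sign x j)"
proof -
  obtain a b where x: "x = (a, b)" by force
  have "(\<Sum>j<n. if j = i then 1 else 0 :: real) \<le> 1" for i by (simp add: sum.delta)
  from this[of a] this[of b]
  have "real n - 4 \<le> (\<Sum>j<n. 1 - 2 * (if j = a then 1 else 0) - 2 * (if j = b then 1 else 0 :: real))"
    unfolding sum_subtractf sum_distrib_left[symmetric] by simp
  also have "\<dots> \<le> (\<Sum>j<n. pair_sign x j)"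
    by (intro sum_mono) (auto simp: pair_sign_def x)
  finally show ?thesis .
qed

context pair_weights
begin

lemma sum_pair_weight_sign:
  assumes "j \<le> n" "Q v \<noteq> 0"
  shows "(\<Sum>x\<in>{..n} \<times> {..n}. pair_weight n c v x * pair_sign x j) = quad_edge n c v j"
proof -
  let ?w = "\<lambda>a b. real (c a b) * v a * v b"
  have row: "(\<Sum>a\<le>n. if a = j then \<Sum>b\<le>n. ?w a b else 0) = v j * L v j"
    using assms(1) by (simp add: lin_form_def sum_distrib_left mult_ac)
  have column: "(\<Sum>a\<le>n. \<Sum>b\<le>n. if b = j then ?w a b else 0) = v j * L v j"
    using assms(1) by (auto simp: lin_form_def sum_distrib_left weight_commute[of _ j] mult_ac
        intro!: sum.cong)
  have "(\<Sum>(a, b)\<in>{..n} \<times> {..n}. ?w a b * pair_sign (a, b) j)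
      = (\<Sum>a\<le>n. \<Sum>b\<le>n. ?w a b - 2 * (if a = j then ?w a b else 0) - 2 * (if b = j then ?w a b else 0))"
    unfolding sum.cartesian_product[symmetric] using weight_diag
    by (intro sum.cong) (auto simp: pair_sign_def)
  also have "\<dots> = (\<Sum>a\<le>n. \<Sum>b\<le>n. ?w a b)
      - 2 * (\<Sum>a\<le>n. \<Sum>b\<le>n. if a = j then ?w a b else 0) - 2 * (\<Sum>a\<le>n. \<Sum>b\<le>n. if b = j then ?w a b else 0)"
    by (simp only: sum_subtractf sum_distrib_left[symmetric])
  also have "(\<Sum>a\<le>n. \<Sum>b\<le>n. if a = j then ?w a b else 0) = v j * L v j"
    unfolding row[symmetric] by (intro sum.cong) auto
  also have "(\<Sum>a\<le>n. \<Sum>b\<le>n. ?w a b) = Q v"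
    using sum_pair_products[of c v n] by (simp add: sum.cartesian_product)
  finally have "(\<Sum>(a, b)\<in>{..n} \<times> {..n}. ?w a b * pair_sign (a, b) j) = Q v - 4 * (v j * L v j)"
    unfolding column by simp
  then show ?thesis
    using assms(2) by (simp add: pair_weight_def quad_edge_def split_beta diff_divide_distrib
        flip: sum_divide_distrib)
qed

lemma quad_form_quad_step:
  assumes "j \<le> n" "L v j \<noteq> 0"
  shows "Q (quad_step n c j v) = 2 * (Q v - 2 * (v j * L v j))"
  unfolding quad_step_def quad_form_fun_upd[OF assms(1)] using assms(2) by (simp add: field_simps)

lemma pair_weight_quad_step:
  assumes j: "j \<le> n" and pos: "0 < v j" "0 < L v j" "0 < Q v" and edge: "0 < quad_edge n c v j"
    and x: "x \<in> {..n} \<times> {..n}"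
  shows "pair_weight n c (quad_step n c j v) x
    = pair_weight n c v x / (1 + quad_edge n c v j * pair_sign x j)"
proof -
  obtain a b where ab: "x = (a, b)" "a \<le> n" "b \<le> n" using x by auto
  define q where "q = Q (quad_step n c j v)"
  have q: "q = 2 * (Q v - 2 * (v j * L v j))"
    using j pos(2) by (simp add: q_def quad_form_quad_step)
  have "1 + quad_edge n c v j = q / Q v"
    using pos(3) by (simp add: quad_edge_def q field_simps)
  moreover have "1 - quad_edge n c v j = 4 * (v j * L v j) / Q v" by (simp add: quad_edge_def)
  moreover have "0 < q"
    using edge pos(3) \<open>1 + quad_edge n c v j = q / Q v\<close>
    by (metis add_pos_pos zero_less_divide_iff zero_less_one less_asym)
  moreover have "Q v / (2 * L v j) - v j = q / (4 * L v j)"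
    using pos(2) by (simp add: q field_simps)
  then have "quad_step n c j v k = (if k = j then q / (4 * L v j) else v k)" for k
    by (simp add: quad_step_def)
  moreover have "c a b = 0" if "a = b" using that ab(2) weight_diag by simp
  ultimately show ?thesis
    using pos by (cases "a = b") (auto simp: ab(1) pair_weight_def pair_sign_def q_def[symmetric])
qed

end

definition column_pairs :: "nat \<Rightarrow> nat \<Rightarrow> nat \<Rightarrow> nat" where
  "column_pairs n a b = (if a < n \<and> b < n \<and> a \<noteq> b then 1 else 0)"

lemma pair_weights_column_pairs: "pair_weights n (column_pairs n)"
  by unfold_locales (auto simp: column_pairs_def)

lemma lin_form_column_pairs:
  "lin_form n (column_pairs n) (\<lambda>_. 1) a = (if a < n then real n - 1 else 0)"
proof -
  have "lin_form n (column_pairs n) (\<lambda>_. 1) a = (\<Sum>b\<in>{..<n} - {a}. if a < n then 1 else 0)"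
    unfolding lin_form_def by (rule sum.mono_neutral_cong_right) (auto simp: column_pairs_def)
  then show ?thesis by (simp add: card_Diff_singleton_if)
qed

lemma quad_form_column_pairs: "quad_form n (column_pairs n) (\<lambda>_. 1) = real n * (real n - 1)"
proof -
  have "{..n} \<inter> {a. a < n} = {..<n}" by auto
  then show ?thesis by (simp add: quad_form_def polar_form_def lin_form_column_pairs sum.If_cases)
qed

lemma quad_edge_column_pairs:
  assumes "2 \<le> n" "j < n"
  shows "quad_edge n (column_pairs n) (\<lambda>_. 1) j = 1 - 4 / n"
proof -
  have "quad_edge n (column_pairs n) (\<lambda>_. 1) j = 1 - 4 * (real n - 1) / (real n * (real n - 1))"
    using assms(2) by (simp only: quad_edge_def quad_form_column_pairs lin_form_column_pairs if_True mult_1)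
  also have "\<dots> = 1 - 4 / n" using assms(1) by (subst mult_divide_mult_cancel_right) auto
  finally show ?thesis .
qed

subsection \<open>Realisation of orbits by sign matrices\<close>

text \<open>States are determined only up to scaling.\<close>

definition quad_orbit ::
  "nat \<Rightarrow> (nat \<Rightarrow> nat \<Rightarrow> nat) \<Rightarrow> (nat \<Rightarrow> nat \<Rightarrow> real) \<Rightarrow> (nat \<Rightarrow> nat) \<Rightarrow> bool" where
  "quad_orbit n c R J \<longleftrightarrow> (\<forall>k. J k < n \<and> selects n c (R k) (J k) \<and>
     (\<exists>s. s \<noteq> 0 \<and> quad_step n c (J k) (R k) = (\<lambda>i. s * R (Suc k) i)))"

lemma ex_rows_with_multiplicity:
  fixes N :: "'a \<Rightarrow> nat"
  assumes "finite X"
  obtains m :: nat and row where "\<And>r. r < m \<Longrightarrow> row r \<in> X \<and> 0 < N (row r)"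
    and "\<And>f :: 'a \<Rightarrow> real. (\<Sum>r<m. f (row r)) = (\<Sum>x\<in>X. N x * f x)"
proof -
  define S where "S = Sigma X (\<lambda>x. {..<N x})"
  have "finite S" using assms by (simp add: S_def)
  then obtain h where h: "bij_betw h {..<card S} S"
    using ex_bij_betw_nat_finite by (auto simp: atLeast0LessThan)
  show ?thesis
  proof (rule that[of "card S" "\<lambda>r. fst (h r)"])
    show "fst (h r) \<in> X \<and> 0 < N (fst (h r))" if "r < card S" for r
      using bij_betwE[OF h] that by (force simp: S_def)
    show "(\<Sum>r<card S. f (fst (h r))) = (\<Sum>x\<in>X. N x * f x)" for f :: "'a \<Rightarrow> real"
      using sum.reindex_bij_betw[OF h, of "\<lambda>x. f (fst x)"] assms
        sum.Sigma[of X "\<lambda>x. {..<N x}" "\<lambda>x _. f x"] by (simp add: S_def split_beta)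
  qed
qed

locale pair_rows = pair_weights +
  fixes w :: "nat \<Rightarrow> nat" and m :: nat and row :: "nat \<Rightarrow> nat \<times> nat"
  assumes w_pos: "\<And>a. a \<le> n \<Longrightarrow> 0 < w a"
    and row: "\<And>r. r < m \<Longrightarrow> row r \<in> {..n} \<times> {..n} \<and> 0 < pair_multiplicity c w (row r)"
    and sum_rows: "\<And>f :: nat \<times> nat \<Rightarrow> real.
      (\<Sum>r<m. f (row r)) = (\<Sum>x\<in>{..n} \<times> {..n}. pair_multiplicity c w x * f x)"
begin

definition pair_matrix :: "nat \<Rightarrow> nat \<Rightarrow> real" where
  "pair_matrix r = pair_sign (row r)"

definition row_dist :: "(nat \<Rightarrow> nat \<Rightarrow> nat) \<Rightarrow> (nat \<Rightarrow> real) \<Rightarrow> nat \<Rightarrow> real" where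
  "row_dist d v r = pair_weight n d v (row r) / pair_multiplicity c w (row r)"

lemma pm1_matrix_pair_matrix: "pm1_matrix m N pair_matrix"
  by (auto simp: pm1_matrix_def pair_matrix_def pair_sign_def split: prod.splits)

lemma sum_row_dist:
  assumes "\<And>a b. a \<le> n \<Longrightarrow> b \<le> n \<Longrightarrow> c a b = 0 \<Longrightarrow> d a b = 0"
  shows "(\<Sum>r<m. row_dist d v r * g (row r)) = (\<Sum>x\<in>{..n} \<times> {..n}. pair_weight n d v x * g x)"
proof -
  have "(\<Sum>r<m. row_dist d v r * g (row r))
      = (\<Sum>x\<in>{..n} \<times> {..n}. pair_multiplicity c w x * (pair_weight n d v x / pair_multiplicity c w x * g x))"
    unfolding row_dist_def by (rule sum_rows)
  also have "\<dots> = (\<Sum>x\<in>{..n} \<times> {..n}. pair_weight n d v x * g x)"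
  proof (rule sum.cong[OF refl])
    fix x assume "x \<in> {..n} \<times> {..n}"
    then obtain a b where "x = (a, b)" "a \<le> n" "b \<le> n" by blast
    then have "pair_multiplicity c w x = 0 \<Longrightarrow> pair_weight n d v x = 0"
      using assms[of a b] w_pos[of a] w_pos[of b] by (auto simp: pair_multiplicity_def pair_weight_def)
    then show "pair_multiplicity c w x * (pair_weight n d v x / pair_multiplicity c w x * g x)
        = pair_weight n d v x * g x"
      by auto
  qed
  finally show ?thesis .
qed

lemma edge_row_dist:
  assumes "pair_weights n d" "\<And>a b. a \<le> n \<Longrightarrow> b \<le> n \<Longrightarrow> c a b = 0 \<Longrightarrow> d a b = 0"
    and "j \<le> n" "quad_form n d v \<noteq> 0"
  shows "edge m pair_matrix (row_dist d v) j = quad_edge n d v j"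
  using sum_row_dist[of d v "\<lambda>x. pair_sign x j"] pair_weights.sum_pair_weight_sign[of n d j v] assms
  by (simp add: edge_def pair_matrix_def)

lemma top_edge_row_dist: "top_edge m n pair_matrix (row_dist c v) = quad_edge n c v j"
  and sel_col_row_dist: "sel_col m n pair_matrix (row_dist c v) = j"
  if "j < n" "selects n c v j"
proof -
  have edge: "edge m pair_matrix (row_dist c v) k = quad_edge n c v k" if "k < n" for k
    using that \<open>selects n c v j\<close> by (intro edge_row_dist pair_weights_axioms) (auto simp: selects_def)
  have less: "quad_edge n c v k < quad_edge n c v j" if "k < n" "k \<noteq> j" for k
    using \<open>selects n c v j\<close> that by (auto simp: selects_def quad_edge_def divide_strict_right_mono)
  have "edge m pair_matrix (row_dist c v) k \<le> edge m pair_matrix (row_dist c v) j" if "k < n" for k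
    using less[OF that] edge that \<open>j < n\<close> by (cases "k = j") auto
  then have top: "top_edge m n pair_matrix (row_dist c v) = edge m pair_matrix (row_dist c v) j"
    using \<open>j < n\<close> by (intro top_edge_eqI)
  then show "sel_col m n pair_matrix (row_dist c v) = j"
    using \<open>j < n\<close> less by (intro sel_col_eqI) (auto simp: edge)
  show "top_edge m n pair_matrix (row_dist c v) = quad_edge n c v j"
    using top \<open>j < n\<close> by (simp add: edge)
qed

lemma row_dist_start:
  fixes S :: real
  assumes "S \<noteq> 0" "\<And>a. a \<le> n \<Longrightarrow> S * v a = w a" "r < m"
  shows "row_dist c v r = 1 / m"
proof -
  have "real m = Q w"
    using sum_rows[of "\<lambda>_. 1"] sum_pair_products[of c "\<lambda>a. real (w a)" n]
    by (simp add: pair_multiplicity_def split_beta)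
  moreover have "Q (\<lambda>a. S * v a) = Q w"
    by (simp add: quad_form_def polar_form_def lin_form_def assms(2))
  moreover obtain a b where "row r = (a, b)" "a \<le> n" "b \<le> n" "0 < c a b * w a * w b"
    using row[OF assms(3)] by (force simp: pair_multiplicity_def)
  moreover have "row_dist c v r = pair_weight n c (\<lambda>a. S * v a) (row r) / pair_multiplicity c w (row r)"
    using assms(1) by (simp add: row_dist_def pair_weight_scale)
  ultimately show ?thesis
    by (simp add: pair_weight_def pair_multiplicity_def assms(2))
qed

lemma ada_iter_pair_matrix:
  fixes S :: real
  assumes orbit: "quad_orbit n c R J" and edge_pos: "\<And>k. 0 < quad_edge n c (R k) (J k)"
    and start: "S \<noteq> 0" "\<And>a. a \<le> n \<Longrightarrow> S * R 0 a = w a" and r: "r < m"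
  shows "ada_iter m n pair_matrix k r = row_dist c (R k) r"
  using r
proof (induction k arbitrary: r)
  case 0
  then show ?case using start by (simp add: row_dist_start)
next
  case (Suc k)
  have J: "J k < n" "selects n c (R k) (J k)" using orbit by (auto simp: quad_orbit_def)
  obtain s where s: "s \<noteq> 0" "quad_step n c (J k) (R k) = (\<lambda>i. s * R (Suc k) i)"
    using orbit unfolding quad_orbit_def by blast
  have "pair_weight n c (R (Suc k)) (row r) = pair_weight n c (quad_step n c (J k) (R k)) (row r)"
    using s by (simp add: pair_weight_scale)
  also have "\<dots> = pair_weight n c (R k) (row r)
      / (1 + quad_edge n c (R k) (J k) * pair_sign (row r) (J k))"
    using J edge_pos row[OF Suc.prems] by (intro pair_weight_quad_step) (auto simp: selects_def)
  finally have step: "pair_weight n c (R (Suc k)) (row r) = pair_weight n c (R k) (row r)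
      / (1 + quad_edge n c (R k) (J k) * pair_matrix r (J k))" by (simp add: pair_matrix_def)
  have "top_edge m n pair_matrix (ada_iter m n pair_matrix k) = quad_edge n c (R k) (J k)"
    "sel_col m n pair_matrix (ada_iter m n pair_matrix k) = J k"
    using top_edge_cong[OF Suc.IH] sel_col_cong[OF Suc.IH] top_edge_row_dist[OF J] sel_col_row_dist[OF J]
    by auto
  then show ?case
    using J Suc by (simp add: ada_step_eq row_dist_def step)
qed

text \<open>The uniform distribution on the pairs of columns equalises all edges.\<close>

lemma margin_pair_matrix_le:
  assumes n: "2 \<le> n" and complete: "\<And>a b. a < n \<Longrightarrow> b < n \<Longrightarrow> a \<noteq> b \<Longrightarrow> 0 < c a b"
  shows "margin m n pair_matrix \<le> 1 - 4 / n"
proof -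
  define D where "D = row_dist (column_pairs n) (\<lambda>_. 1)"
  note pairs = pair_weights_column_pairs[of n] and quad = quad_form_column_pairs[of n]
  have support: "column_pairs n a b = 0" if "a \<le> n" "b \<le> n" "c a b = 0" for a b
    using that(3) complete[of a b] by (fastforce simp: column_pairs_def)
  have "edge m pair_matrix D j = 1 - 4 / n" if "j < n" for j
  proof -
    have "edge m pair_matrix D j = quad_edge n (column_pairs n) (\<lambda>_. 1) j"
      unfolding D_def using that n by (intro edge_row_dist pairs support) (auto simp: quad)
    then show ?thesis by (simp only: quad_edge_column_pairs[OF n that])
  qed
  then have "top_edge m n pair_matrix D = 1 - 4 / n"
    using n by (subst top_edge_eqI[of 0]) auto
  moreover have "(\<Sum>r<m. D r) = 1"
    using sum_row_dist[OF support, where g = "\<lambda>_. 1"] sum_pair_weight[of n "column_pairs n" "\<lambda>_. 1"] n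
    by (simp add: D_def quad)
  moreover have "0 \<le> D r" for r
    using n by (simp add: D_def row_dist_def pair_weight_def quad split_beta)
  ultimately show ?thesis
    using margin_le_top_edge[OF pm1_matrix_pair_matrix, of n D] n by (simp add: prob_simplex_def)
qed

lemma margin_pair_matrix_ge:
  assumes "0 < m" "0 < n"
  shows "1 - 4 / n \<le> margin m n pair_matrix"
proof (rule margin_ge_average_row_sum[OF assms])
  have "real n * (1 - 4 / n) = real n - 4" using assms(2) by (simp add: right_diff_distrib)
  then show "real n * (1 - 4 / n) \<le> (\<Sum>j<n. pair_matrix r j)" for r
    using sum_pair_sign_ge[of n "row r"] by (simp only: pair_matrix_def)
qed

end

theorem (in pair_weights) quad_orbit_realisation:
  fixes S :: real
  assumes orbit: "quad_orbit n c R J" and edge_pos: "\<And>k. 0 < quad_edge n c (R k) (J k)"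
    and start: "S \<noteq> 0" "\<And>a. a \<le> n \<Longrightarrow> S * R 0 a = real (w a)" "\<And>a. a \<le> n \<Longrightarrow> 0 < w a"
    and n: "2 \<le> n" and complete: "\<And>a b. a < n \<Longrightarrow> b < n \<Longrightarrow> a \<noteq> b \<Longrightarrow> 0 < c a b"
  obtains m M where "regular_run m n M" "margin m n M = 1 - 4 / n"
    "(\<lambda>k. top_edge m n M (ada_iter m n M k)) = (\<lambda>k. quad_edge n c (R k) (J k))"
proof (rule ex_rows_with_multiplicity[of "{..n} \<times> {..n}" "pair_multiplicity c w"])
  show "finite ({..n} \<times> {..n})" by simp
  fix m :: nat and row
  assume "\<And>r. r < m \<Longrightarrow> row r \<in> {..n} \<times> {..n} \<and> 0 < pair_multiplicity c w (row r)"
    and "\<And>f :: nat \<times> nat \<Rightarrow> real.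
      (\<Sum>r<m. f (row r)) = (\<Sum>x\<in>{..n} \<times> {..n}. pair_multiplicity c w x * f x)"
  then interpret pair_rows n c w m row
    using start(3) by unfold_locales
  have orbitD: "J k < n" "selects n c (R k) (J k)" for k using orbit by (auto simp: quad_orbit_def)
  have top: "top_edge m n pair_matrix (ada_iter m n pair_matrix k) = quad_edge n c (R k) (J k)" for k
    using top_edge_row_dist[OF orbitD] ada_iter_pair_matrix[OF orbit edge_pos start(1,2)]
      top_edge_cong[of m "ada_iter m n pair_matrix k" "row_dist c (R k)" n pair_matrix] by simp
  have "0 < (\<Sum>x\<in>{..n} \<times> {..n}. pair_multiplicity c w x)"
    using n complete[of 0 1] start(3) by (intro sum_pos2[of _ "(0, 1)"]) (auto simp: pair_multiplicity_def)
  then have "0 < m"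
    using sum_rows[of "\<lambda>_. 1"] by (simp flip: of_nat_sum)
  moreover have "\<bar>quad_edge n c (R k) (J k)\<bar> < 1" for k
    using edge_pos[of k] orbitD[of k] by (auto simp: selects_def quad_edge_def)
  ultimately have "regular_run m n pair_matrix"
    using n by (simp add: regular_run_def pm1_matrix_pair_matrix top)
  moreover have "margin m n pair_matrix = 1 - 4 / n"
    using margin_pair_matrix_le[OF n complete] margin_pair_matrix_ge[OF \<open>0 < m\<close>] n
    by (intro antisym) auto
  ultimately show ?thesis using top by (intro that) auto
qed

section \<open>Perturbed cycles\<close>

lemma tendsto_fun_iff:
  fixes f :: "'a \<Rightarrow> 'b \<Rightarrow> 'c :: topological_space"
  shows "(f \<longlongrightarrow> l) F \<longleftrightarrow> (\<forall>i. ((\<lambda>x. f x i) \<longlongrightarrow> l i) F)"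
  using limitin_componentwise[of "\<lambda>_ :: 'b. euclidean :: 'c topology" UNIV f l F]
  by (simp add: euclidean_product_topology)

lemma eventually_at_right_ball_compact:
  fixes P :: "real \<Rightarrow> 'a :: topological_space \<Rightarrow> bool"
  assumes "compact K" and near: "\<And>y. y \<in> K \<Longrightarrow> \<forall>\<^sub>F q in nhds (0, y). P (fst q) (snd q)"
  shows "\<forall>\<^sub>F h in at_right 0. \<forall>y\<in>K. P h y"
proof -
  define W where "W = interior {q. P (fst q) (snd q)}"
  have "(0, y) \<in> W" if "y \<in> K" for y
    using near[OF that] unfolding W_def eventually_nhds interior_def by blast
  then have "{0} \<times> K \<subseteq> W" by blast
  from Elementary_Topology.tube_lemma[OF \<open>compact K\<close> _ this]
  obtain U where U: "0 \<in> U" "open U" "U \<times> K \<subseteq> W" by (auto simp: W_def)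
  have "P h y" if "h \<in> U" "y \<in> K" for h y
    using subsetD[OF U(3), of "(h, y)"] subsetD[OF interior_subset, of "(h, y)"] that
    by (force simp: W_def)
  moreover have "\<forall>\<^sub>F h in at_right 0. h \<in> U"
    using eventually_nhds_in_open[OF U(2,1)] by (rule filter_leD[OF at_within_le_nhds])
  ultimately show ?thesis by (auto elim: eventually_mono)
qed

lemma eventually_at_right_bounded_compact:
  fixes f :: "real \<Rightarrow> 'a :: topological_space \<Rightarrow> real"
  assumes "compact K"
    and lim: "\<And>y. y \<in> K \<Longrightarrow> ((\<lambda>q. f (fst q) (snd q)) \<longlongrightarrow> f 0 y) (nhds (0, y))"
  obtains C where "0 < C" "\<forall>\<^sub>F h in at_right 0. \<forall>y\<in>K. \<bar>f h y\<bar> \<le> C"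
proof -
  have "continuous_on K (f 0)"
    unfolding continuous_on_def
  proof
    fix y assume "y \<in> K"
    have "((\<lambda>z. (0, z)) \<longlongrightarrow> (0 :: real, y)) (at y within K)"
      by (intro tendsto_intros)
    from filterlim_compose[OF lim[OF \<open>y \<in> K\<close>] this]
    show "(f 0 \<longlongrightarrow> f 0 y) (at y within K)" by simp
  qed
  then have "bounded (f 0 ` K)"
    using \<open>compact K\<close> by (intro compact_imp_bounded compact_continuous_image)
  then obtain B where B: "0 < B" "\<And>y. y \<in> K \<Longrightarrow> \<bar>f 0 y\<bar> \<le> B"
    unfolding bounded_pos by auto
  have "\<forall>\<^sub>F h in at_right 0. \<forall>y\<in>K. \<bar>f h y\<bar> < B + 1"
  proof (rule eventually_at_right_ball_compact[OF \<open>compact K\<close>])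
    fix y assume "y \<in> K"
    then show "\<forall>\<^sub>F q in nhds (0, y). \<bar>f (fst q) (snd q)\<bar> < B + 1"
      using B(2) by (intro order_tendstoD(2)[OF tendsto_rabs[OF lim]]) fastforce+
  qed
  then have "\<forall>\<^sub>F h in at_right 0. \<forall>y\<in>K. \<bar>f h y\<bar> \<le> B + 1"
    by (rule eventually_mono) (auto simp: less_imp_le)
  then show ?thesis using B(1) by (intro that[of "B + 1"]) auto
qed

primrec updates :: "('a \<Rightarrow> 'b) \<Rightarrow> (nat \<Rightarrow> 'a) \<Rightarrow> (nat \<Rightarrow> 'b) \<Rightarrow> nat \<Rightarrow> 'a \<Rightarrow> 'b" where
  "updates f js w 0 = f"
| "updates f js w (Suc t) = (updates f js w t)(js t := w t)"

definition perturb_step ::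
  "nat \<Rightarrow> (nat \<Rightarrow> nat \<Rightarrow> nat) \<Rightarrow> (nat \<Rightarrow> real) \<Rightarrow> real \<Rightarrow> nat \<Rightarrow> real \<Rightarrow> (nat \<Rightarrow> real) \<Rightarrow> real" where
  "perturb_step n c V W j h y =
     (polar_form n c V y - y j * lin_form n c V j - (V j + W) * lin_form n c y j
       + h * (quad_form n c y / 2 - y j * lin_form n c y j)) / (lin_form n c V j + h * lin_form n c y j)"

text \<open>If the step at \<open>j\<close> moves \<open>V j\<close> to \<open>W\<close>, then it acts on the perturbation \<open>y\<close> of \<open>V + h y\<close> by a map
  that is regular at \<open>h = 0\<close>.\<close>

lemma (in pair_weights) quad_step_perturb:
  assumes balance: "Q V = 2 * (V j + W) * L V j" and d: "L V j + h * L y j \<noteq> 0"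
  shows "quad_step n c j (\<lambda>k. V k + h * y k)
    = (\<lambda>k. (V(j := W)) k + h * (y(j := perturb_step n c V W j h y)) k)"
proof -
  define s where "s = polar_form n c V y - y j * L V j - (V j + W) * L y j + h * (Q y / 2 - y j * L y j)"
  have "Q (\<lambda>k. V k + h * y k)
      = 2 * (V j + h * y j) * (L V j + h * L y j) + 2 * (W * (L V j + h * L y j) + h * s)"
    by (simp add: quad_form_add_scaled balance s_def algebra_simps power2_eq_square)
  then have "Q (\<lambda>k. V k + h * y k) / (2 * (L V j + h * L y j)) - (V j + h * y j)
      = W + h * (s / (L V j + h * L y j))"
    using d by (simp add: divide_simps) (simp add: algebra_simps)
  then show ?thesis
    by (auto simp: quad_step_def lin_form_add_scaled perturb_step_def s_def fun_eq_iff)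
qed

locale cycle_data = pair_weights +
  fixes p :: nat and js :: "nat \<Rightarrow> nat" and W :: "nat \<Rightarrow> real"
begin

definition V :: "nat \<Rightarrow> nat \<Rightarrow> real" where
  "V = updates (\<lambda>k. if k < n then 1 else 0) js W"

lemma V_0: "V 0 = (\<lambda>k. if k < n then 1 else 0)"
  and V_Suc: "V (Suc t) = (V t)(js t := W t)"
  by (simp_all add: V_def)

primrec Y :: "nat \<Rightarrow> real \<Rightarrow> (nat \<Rightarrow> real) \<Rightarrow> nat \<Rightarrow> real" where
  "Y 0 h y = y"
| "Y (Suc t) h y = (Y t h y)(js t := perturb_step n c (V t) (W t) (js t) h (Y t h y))"

definition X :: "nat \<Rightarrow> real \<Rightarrow> (nat \<Rightarrow> real) \<Rightarrow> nat \<Rightarrow> real" where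
  "X t h y = (\<lambda>k. V t k + h * Y t h y k)"

definition return_map :: "real \<Rightarrow> (nat \<Rightarrow> real) \<Rightarrow> nat \<Rightarrow> real" where
  "return_map h y = (\<lambda>k. Y p h y k - V 0 k * Y p h y 0)"

end

text \<open>\<open>V\<close> is an exact cycle of the system without the dummy coordinate: one turn multiplies it by \<open>\<kappa>\<close>.\<close>

locale quad_cycle = cycle_data +
  fixes \<kappa> \<alpha> :: real
  assumes js_less: "\<And>t. t < p \<Longrightarrow> js t < n" and p_pos: "0 < p"
    and W_pos: "\<And>t. t < p \<Longrightarrow> 0 < W t"
    and growth: "\<And>k. k < n \<Longrightarrow> V p k = \<kappa>" "1 < \<kappa>"
    and balance: "\<And>t. t < p \<Longrightarrow> Q (V t) = 2 * (V t (js t) + W t) * L (V t) (js t)"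
    and L_pos: "\<And>t. t < p \<Longrightarrow> 0 < L (V t) (js t)"
    and strict_min: "\<And>t k. t < p \<Longrightarrow> k < n \<Longrightarrow> k \<noteq> js t \<Longrightarrow>
      V t (js t) * L (V t) (js t) < V t k * L (V t) k"
    and first_edge: "(W 0 - V 0 (js 0)) / (W 0 + V 0 (js 0)) = \<alpha>"
    and later_edges: "\<And>t. 0 < t \<Longrightarrow> t < p \<Longrightarrow> \<alpha> < (W t - V t (js t)) / (W t + V t (js t))"
begin

lemma n_pos: "0 < n"
  using js_less[OF p_pos] by simp

lemma V_pos: "t \<le> p \<Longrightarrow> k < n \<Longrightarrow> 0 < V t k"
  by (induction t) (auto simp: V_0 V_Suc W_pos)

lemma V_dummy: "t \<le> p \<Longrightarrow> n \<le> k \<Longrightarrow> V t k = 0"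
proof (induction t)
  case (Suc t)
  then show ?case using js_less[of t] by (simp add: V_Suc)
qed (simp add: V_0)

lemma Y_dummy: "t \<le> p \<Longrightarrow> n \<le> k \<Longrightarrow> Y t h y k = y k"
proof (induction t)
  case (Suc t)
  then show ?case using js_less[of t] by simp
qed simp

lemma V_p: "V p k = \<kappa> * V 0 k"
  using growth(1)[of k] V_dummy[of p k] by (cases "k < n") (auto simp: V_0)

lemma Q_V_pos: "t < p \<Longrightarrow> 0 < Q (V t)"
  using V_pos[of t "js t"] js_less[of t] W_pos[of t] L_pos[of t] by (simp add: balance)

lemma quad_edge_V:
  assumes "t < p"
  shows "quad_edge n c (V t) (js t) = (W t - V t (js t)) / (W t + V t (js t))"
proof -
  have pos: "0 < V t (js t) + W t"
    using V_pos[of t "js t"] js_less[OF assms] W_pos[OF assms] assms by simp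
  have "4 * (V t (js t) * L (V t) (js t)) / Q (V t) = 2 * V t (js t) / (V t (js t) + W t)"
    using L_pos[OF assms] pos by (simp add: balance[OF assms] divide_simps)
  then show ?thesis using pos by (simp add: quad_edge_def field_simps)
qed

lemma quad_edge_V_0: "quad_edge n c (V 0) (js 0) = \<alpha>"
  unfolding quad_edge_V[OF p_pos] by (rule first_edge)

lemma quad_step_X:
  assumes "t < p" "L (X t h y) (js t) \<noteq> 0"
  shows "quad_step n c (js t) (X t h y) = X (Suc t) h y"
  using quad_step_perturb[OF balance[OF assms(1)], of h "Y t h y"] assms(2)
  by (simp add: X_def V_Suc lin_form_add_scaled)

lemma X_p:
  assumes "\<kappa> + h * Y p h y 0 \<noteq> 0"
  shows "X p h y = (\<lambda>k. (\<kappa> + h * Y p h y 0) * X 0 (h / (\<kappa> + h * Y p h y 0)) (return_map h y) k)"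
  using assms by (auto simp: X_def V_p return_map_def distrib_left) (simp_all add: algebra_simps)

lemma tendsto_lin_form:
  assumes "\<And>k. k \<le> n \<Longrightarrow> ((\<lambda>x. v x k) \<longlongrightarrow> u k) F"
  shows "((\<lambda>x. L (v x) j) \<longlongrightarrow> L u j) F"
  unfolding lin_form_def using assms by (intro tendsto_intros) auto

lemma tendsto_polar_form:
  assumes "\<And>k. k \<le> n \<Longrightarrow> ((\<lambda>x. v x k) \<longlongrightarrow> u k) F"
  shows "((\<lambda>x. polar_form n c V' (v x)) \<longlongrightarrow> polar_form n c V' u) F"
  unfolding polar_form_def using assms by (intro tendsto_intros) auto

lemma tendsto_quad_form:
  assumes "\<And>k. k \<le> n \<Longrightarrow> ((\<lambda>x. v x k) \<longlongrightarrow> u k) F"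
  shows "((\<lambda>x. Q (v x)) \<longlongrightarrow> Q u) F"
  unfolding quad_form_def polar_form_def using assms by (intro tendsto_intros tendsto_lin_form) auto

lemma tendsto_nhds_coordinates:
  fixes y :: "nat \<Rightarrow> real"
  shows "((\<lambda>q. fst q) \<longlongrightarrow> h) (nhds (h, y))" "((\<lambda>q. snd q k) \<longlongrightarrow> y k) (nhds (h, y))"
proof -
  have "(snd \<longlongrightarrow> y) (nhds (h, y))" using tendsto_snd[OF filterlim_ident] by force
  then show "((\<lambda>q. snd q k) \<longlongrightarrow> y k) (nhds (h, y))" by (simp add: tendsto_fun_iff)
  show "((\<lambda>q. fst q) \<longlongrightarrow> h) (nhds (h, y))" using tendsto_fst[OF filterlim_ident] by force
qed

lemma tendsto_Y: "t \<le> p \<Longrightarrow> ((\<lambda>q. Y t (fst q) (snd q) k) \<longlongrightarrow> Y t 0 y k) (nhds (0, y))"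
proof (induction t arbitrary: k)
  case 0
  then show ?case by (simp add: tendsto_nhds_coordinates)
next
  case (Suc t)
  then have "t < p" and IH: "\<And>k. ((\<lambda>q. Y t (fst q) (snd q) k) \<longlongrightarrow> Y t 0 y k) (nhds (0, y))" by auto
  have "((\<lambda>q. perturb_step n c (V t) (W t) (js t) (fst q) (Y t (fst q) (snd q)))
      \<longlongrightarrow> perturb_step n c (V t) (W t) (js t) 0 (Y t 0 y)) (nhds (0, y))"
    unfolding perturb_step_def using L_pos[OF \<open>t < p\<close>]
    by (intro tendsto_intros tendsto_nhds_coordinates tendsto_lin_form tendsto_polar_form
        tendsto_quad_form IH) auto
  then show ?case using IH by simp
qed

lemma tendsto_X:
  assumes "t \<le> p"
  shows "((\<lambda>q. X t (fst q) (snd q) k) \<longlongrightarrow> V t k) (nhds (0, y))"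
proof -
  have "((\<lambda>q. X t (fst q) (snd q) k) \<longlongrightarrow> V t k + 0 * Y t 0 y k) (nhds (0, y))"
    unfolding X_def by (intro tendsto_intros tendsto_nhds_coordinates tendsto_Y assms)
  then show ?thesis by simp
qed

lemma tendsto_quad_edge_X:
  assumes "t < p"
  shows "((\<lambda>q. quad_edge n c (X t (fst q) (snd q)) (js t)) \<longlongrightarrow> quad_edge n c (V t) (js t)) (nhds (0, y))"
  unfolding quad_edge_def using assms Q_V_pos[OF assms]
  by (intro tendsto_intros tendsto_lin_form tendsto_quad_form tendsto_X) auto

lemma tendsto_return_map:
  "((\<lambda>q. return_map (fst q) (snd q)) \<longlongrightarrow> return_map 0 y) (nhds (0, y))"
  unfolding tendsto_fun_iff return_map_def by (intro allI tendsto_intros tendsto_Y) auto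

lemma eventually_selects_X:
  assumes "t < p"
  shows "\<forall>\<^sub>F q in nhds (0, y). selects n c (X t (fst q) (snd q)) (js t)"
proof -
  let ?X = "\<lambda>q. X t (fst q) (snd q)" and ?F = "nhds (0, y)"
  have X: "((\<lambda>q. ?X q k) \<longlongrightarrow> V t k) ?F" for k using assms by (intro tendsto_X) simp
  have "\<forall>\<^sub>F q in ?F. \<forall>k\<in>{..<n}. 0 < ?X q k"
    using assms V_pos by (intro eventually_ball_finite ballI order_tendstoD(1)[OF X]) auto
  moreover have "\<forall>\<^sub>F q in ?F. 0 < Q (?X q)" "\<forall>\<^sub>F q in ?F. 0 < L (?X q) (js t)"
    using Q_V_pos[OF assms] L_pos[OF assms]
    by (auto intro!: order_tendstoD(1)[OF tendsto_quad_form] order_tendstoD(1)[OF tendsto_lin_form] X)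
  moreover have "\<forall>\<^sub>F q in ?F. \<forall>k\<in>{..<n} - {js t}. ?X q (js t) * L (?X q) (js t) < ?X q k * L (?X q) k"
  proof (intro eventually_ball_finite ballI)
    fix k assume k: "k \<in> {..<n} - {js t}"
    have "((\<lambda>q. ?X q k * L (?X q) k - ?X q (js t) * L (?X q) (js t))
        \<longlongrightarrow> V t k * L (V t) k - V t (js t) * L (V t) (js t)) ?F"
      by (intro tendsto_intros tendsto_lin_form X)
    from order_tendstoD(1)[OF this, of 0]
    show "\<forall>\<^sub>F q in ?F. ?X q (js t) * L (?X q) (js t) < ?X q k * L (?X q) k"
      using strict_min[OF assms, of k] k by simp
  qed simp
  ultimately show ?thesis
    unfolding selects_def by eventually_elim auto
qed

lemma later_edges_gap:
  obtains \<eta> where "0 < \<eta>" "\<And>t. 0 < t \<Longrightarrow> t < p \<Longrightarrow> \<alpha> + \<eta> < quad_edge n c (V t) (js t)"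
proof -
  have lim: "((\<lambda>\<eta>. \<alpha> + \<eta>) \<longlongrightarrow> \<alpha>) (at_right 0)"
    by (rule tendsto_eq_intros | simp)+
  have "\<forall>\<^sub>F \<eta> in at_right 0. \<forall>t\<in>{1..<p}. \<alpha> + \<eta> < quad_edge n c (V t) (js t)"
    using later_edges by (intro eventually_ball_finite ballI order_tendstoD(2)[OF lim])
      (auto simp: quad_edge_V)
  moreover have "\<forall>\<^sub>F \<eta> in at_right 0. (0 :: real) < \<eta>" by (rule eventually_at_right_less)
  ultimately have "\<forall>\<^sub>F \<eta> in at_right 0. 0 < \<eta> \<and> (\<forall>t\<in>{1..<p}. \<alpha> + \<eta> < quad_edge n c (V t) (js t))"
    by eventually_elim simp
  then obtain \<eta> where "0 < \<eta>" "\<forall>t\<in>{1..<p}. \<alpha> + \<eta> < quad_edge n c (V t) (js t)"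
    using eventually_happens'[OF trivial_limit_at_right_real] by blast
  then show ?thesis by (intro that) auto
qed

text \<open>The derivative at \<open>h = 0\<close> of the excess of the first edge over \<open>\<alpha>\<close>, times \<open>Q (V 0)\<close>.\<close>

definition drift :: "(nat \<Rightarrow> real) \<Rightarrow> real" where
  "drift y = 2 * (1 - \<alpha>) * polar_form n c (V 0) y
     - 4 * (y (js 0) * L (V 0) (js 0) + V 0 (js 0) * L y (js 0))"

definition excess_rate :: "real \<Rightarrow> (nat \<Rightarrow> real) \<Rightarrow> real" where
  "excess_rate h y = (drift y + h * ((1 - \<alpha>) * Q y - 4 * (y (js 0) * L y (js 0)))) / Q (X 0 h y)"

lemma quad_edge_X_0:
  assumes "Q (X 0 h y) \<noteq> 0"
  shows "quad_edge n c (X 0 h y) (js 0) - \<alpha> = h * excess_rate h y"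
proof -
  have "(1 - \<alpha>) * Q (V 0) = 4 * (V 0 (js 0) * L (V 0) (js 0))"
    using quad_edge_V_0 Q_V_pos[OF p_pos] by (simp add: quad_edge_def field_simps)
  moreover have "Q (X 0 h y) = Q (V 0) + 2 * h * polar_form n c (V 0) y + h\<^sup>2 * Q y"
    "L (X 0 h y) (js 0) = L (V 0) (js 0) + h * L y (js 0)" "X 0 h y (js 0) = V 0 (js 0) + h * y (js 0)"
    by (simp_all add: X_def quad_form_add_scaled lin_form_add_scaled)
  ultimately have "(1 - \<alpha>) * Q (X 0 h y) - 4 * (X 0 h y (js 0) * L (X 0 h y) (js 0))
      = h * (drift y + h * ((1 - \<alpha>) * Q y - 4 * (y (js 0) * L y (js 0))))"
    by (simp add: drift_def algebra_simps power2_eq_square)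
  moreover have "quad_edge n c (X 0 h y) (js 0) - \<alpha>
      = ((1 - \<alpha>) * Q (X 0 h y) - 4 * (X 0 h y (js 0) * L (X 0 h y) (js 0))) / Q (X 0 h y)"
    using assms by (simp add: quad_edge_def diff_divide_distrib)
  ultimately show ?thesis by (simp add: excess_rate_def)
qed

lemma tendsto_excess_rate:
  "((\<lambda>q. excess_rate (fst q) (snd q)) \<longlongrightarrow> excess_rate 0 y) (nhds (0, y))"
proof -
  have "X 0 0 y = V 0" by (simp add: X_def)
  then show ?thesis
    unfolding excess_rate_def drift_def using Q_V_pos[OF p_pos] tendsto_X[of 0]
    by (intro tendsto_intros tendsto_nhds_coordinates tendsto_lin_form tendsto_polar_form
        tendsto_quad_form) auto
qed

end

subsection \<open>Orbits near the cycle\<close>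

lemma perturbed_geometric:
  fixes s :: "nat \<Rightarrow> real"
  assumes \<kappa>: "1 < \<kappa>" and s: "\<And>i. \<bar>s (Suc i) - \<kappa> * s i\<bar> \<le> C"
  defines "m \<equiv> C / (\<kappa> - 1)"
  shows "\<kappa> ^ i * (s 0 - m) \<le> s i - m" "s i + m \<le> \<kappa> ^ i * (s 0 + m)"
proof -
  have m: "\<kappa> * m = m + C" using \<kappa> by (simp add: m_def field_simps)
  show "\<kappa> ^ i * (s 0 - m) \<le> s i - m"
  proof (induction i)
    case (Suc i)
    then have "\<kappa> ^ Suc i * (s 0 - m) \<le> \<kappa> * (s i - m)" using \<kappa> by simp
    also have "\<dots> \<le> s (Suc i) - m" using s[of i] m by (simp add: right_diff_distrib)
    finally show ?case .
  qed simp
  show "s i + m \<le> \<kappa> ^ i * (s 0 + m)"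
  proof (induction i)
    case (Suc i)
    have "s (Suc i) + m \<le> \<kappa> * (s i + m)" using s[of i] m by (simp add: distrib_left)
    also have "\<dots> \<le> \<kappa> ^ Suc i * (s 0 + m)" using Suc \<kappa> by simp
    finally show ?case .
  qed simp
qed

definition normalized :: "nat \<Rightarrow> (nat \<Rightarrow> real) set" where
  "normalized n = {y. y 0 = 0 \<and> y n = 1 \<and> (\<forall>k>n. y k = 0)}"

locale trapped_cycle = quad_cycle +
  fixes K :: "(nat \<Rightarrow> real) set"
  assumes compact_K: "compact K" and K_normalized: "K \<subseteq> normalized n"
    and K_trap: "\<And>y. y \<in> K \<Longrightarrow> \<forall>\<^sub>F z in nhds (return_map 0 y). z \<in> normalized n \<longrightarrow> z \<in> K"
    and K_drift: "\<And>y. y \<in> K \<Longrightarrow> 0 < drift y"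
begin

lemma return_map_normalized: "y \<in> K \<Longrightarrow> return_map h y \<in> normalized n"
  using K_normalized n_pos by (auto simp: return_map_def normalized_def Y_dummy V_0)

lemma eventually_return_map: "\<forall>\<^sub>F h in at_right 0. \<forall>y\<in>K. return_map h y \<in> K"
proof -
  have "\<forall>\<^sub>F h in at_right 0. \<forall>y\<in>K. return_map h y \<in> normalized n \<longrightarrow> return_map h y \<in> K"
    using compact_K eventually_compose_filterlim[OF K_trap tendsto_return_map]
    by (rule eventually_at_right_ball_compact)
  then show ?thesis by (rule eventually_mono) (simp add: return_map_normalized)
qed

lemma eventually_excess_bounds:
  obtains A B where "0 < A" "\<forall>\<^sub>F h in at_right 0. \<forall>y\<in>K.
    A * h \<le> quad_edge n c (X 0 h y) (js 0) - \<alpha> \<and> quad_edge n c (X 0 h y) (js 0) - \<alpha> \<le> B * h"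
proof -
  have pos: "0 < excess_rate 0 y" if "y \<in> K" for y
    using K_drift[OF that] Q_V_pos[OF p_pos] by (simp add: excess_rate_def X_def)
  obtain B where B: "\<forall>\<^sub>F h in at_right 0. \<forall>y\<in>K. \<bar>excess_rate h y\<bar> \<le> B"
    using compact_K tendsto_excess_rate by (rule eventually_at_right_bounded_compact)
  have "((\<lambda>q. inverse (excess_rate (fst q) (snd q))) \<longlongrightarrow> inverse (excess_rate 0 y)) (nhds (0, y))"
    if "y \<in> K" for y
    using pos[OF that] by (intro tendsto_inverse tendsto_excess_rate) simp
  then obtain A where A: "0 < A" "\<forall>\<^sub>F h in at_right 0. \<forall>y\<in>K. \<bar>inverse (excess_rate h y)\<bar> \<le> A"
    using eventually_at_right_bounded_compact[OF compact_K, of "\<lambda>h y. inverse (excess_rate h y)"] by blast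
  have "\<forall>\<^sub>F h in at_right 0. \<forall>y\<in>K. 0 < excess_rate h y"
    using compact_K order_tendstoD(1)[OF tendsto_excess_rate pos] by (rule eventually_at_right_ball_compact)
  moreover have "\<forall>\<^sub>F h in at_right 0. \<forall>y\<in>K. 0 < Q (X 0 h y)"
  proof (rule eventually_at_right_ball_compact[OF compact_K])
    show "\<forall>\<^sub>F q in nhds (0, y). 0 < Q (X 0 (fst q) (snd q))" for y
      using eventually_selects_X[OF p_pos] by (rule eventually_mono) (simp add: selects_def)
  qed
  moreover have "\<forall>\<^sub>F h in at_right 0. (0 :: real) < h" by (rule eventually_at_right_less)
  ultimately have "\<forall>\<^sub>F h in at_right 0. \<forall>y\<in>K.
      inverse A * h \<le> quad_edge n c (X 0 h y) (js 0) - \<alpha> \<and> quad_edge n c (X 0 h y) (js 0) - \<alpha> \<le> B * h"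
    using A(2) B
  proof eventually_elim
    case (elim h)
    have "inverse A \<le> excess_rate h y \<and> excess_rate h y \<le> B" if "y \<in> K" for y
      using elim that A(1) by (auto simp: abs_le_iff dest!: bspec intro: inverse_le_imp_le)
    then show ?case
      using elim by (auto simp: quad_edge_X_0 mult.commute[of _ h])
  qed
  then show ?thesis using A(1) by (intro that[of "inverse A"]) auto
qed

definition good_turn :: "real \<Rightarrow> real \<Rightarrow> real \<Rightarrow> real \<Rightarrow> real \<Rightarrow> (nat \<Rightarrow> real) \<Rightarrow> bool" where
  "good_turn \<eta> A B C h y \<longleftrightarrow>
     (\<forall>t<p. selects n c (X t h y) (js t) \<and> (0 < t \<longrightarrow> \<alpha> + \<eta> \<le> quad_edge n c (X t h y) (js t))) \<and>
     A * h \<le> quad_edge n c (X 0 h y) (js 0) - \<alpha> \<and> quad_edge n c (X 0 h y) (js 0) - \<alpha> \<le> B * h \<and>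
     \<bar>Y p h y 0\<bar> \<le> C \<and> return_map h y \<in> K"

lemma eventually_good_turn:
  obtains \<eta> A B C where "0 < \<eta>" "0 < A" "0 < C" "\<forall>\<^sub>F h in at_right 0. \<forall>y\<in>K. good_turn \<eta> A B C h y"
proof -
  obtain A B where A: "0 < A" and excess: "\<forall>\<^sub>F h in at_right 0. \<forall>y\<in>K.
      A * h \<le> quad_edge n c (X 0 h y) (js 0) - \<alpha> \<and> quad_edge n c (X 0 h y) (js 0) - \<alpha> \<le> B * h"
    by (rule eventually_excess_bounds)
  obtain C where C: "0 < C" "\<forall>\<^sub>F h in at_right 0. \<forall>y\<in>K. \<bar>Y p h y 0\<bar> \<le> C"
    using compact_K tendsto_Y[OF order_refl] by (rule eventually_at_right_bounded_compact)
  obtain \<eta> where \<eta>: "0 < \<eta>" "\<And>t. 0 < t \<Longrightarrow> t < p \<Longrightarrow> \<alpha> + \<eta> < quad_edge n c (V t) (js t)"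
    by (rule later_edges_gap) blast
  have "\<forall>\<^sub>F h in at_right 0. \<forall>y\<in>K. \<forall>t\<in>{..<p}. selects n c (X t h y) (js t) \<and>
      (0 < t \<longrightarrow> \<alpha> + \<eta> \<le> quad_edge n c (X t h y) (js t))"
  proof (intro eventually_at_right_ball_compact[OF compact_K] eventually_ball_finite ballI eventually_conj)
    fix y t assume "t \<in> {..<p}"
    then show "\<forall>\<^sub>F q in nhds (0, y). selects n c (X t (fst q) (snd q)) (js t)"
      by (intro eventually_selects_X) simp
    show "\<forall>\<^sub>F q in nhds (0, y). 0 < t \<longrightarrow> \<alpha> + \<eta> \<le> quad_edge n c (X t (fst q) (snd q)) (js t)"
    proof (cases "0 < t")
      case True
      have "\<forall>\<^sub>F q in nhds (0, y). \<alpha> + \<eta> < quad_edge n c (X t (fst q) (snd q)) (js t)"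
        using \<open>t \<in> {..<p}\<close> \<eta>(2)[OF True] by (intro order_tendstoD(1)[OF tendsto_quad_edge_X]) auto
      then show ?thesis by (rule eventually_mono) simp
    qed simp
  qed simp
  then have "\<forall>\<^sub>F h in at_right 0. \<forall>y\<in>K. good_turn \<eta> A B C h y"
    using excess C(2) eventually_return_map by eventually_elim (simp add: good_turn_def)
  then show ?thesis using \<eta>(1) A C(1) by (intro that)
qed

text \<open>One turn maps the state with parameters \<open>(h, y)\<close> to a multiple of a state of the same form.\<close>

primrec turn :: "real \<Rightarrow> (nat \<Rightarrow> real) \<Rightarrow> nat \<Rightarrow> real \<times> (nat \<Rightarrow> real)" where
  "turn h y 0 = (h, y)"
| "turn h y (Suc i) = (case turn h y i of (h, y) \<Rightarrow> (h / (\<kappa> + h * Y p h y 0), return_map h y))"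

definition orbit :: "real \<Rightarrow> (nat \<Rightarrow> real) \<Rightarrow> nat \<Rightarrow> nat \<Rightarrow> real" where
  "orbit h y k = (case turn h y (k div p) of (h, y) \<Rightarrow> X (k mod p) h y)"

lemma orbit_0: "orbit h y 0 = X 0 h y"
  by (simp add: orbit_def)

end

locale good_start = trapped_cycle +
  fixes \<eta> A B C h0 :: real and h y
  assumes pos: "0 < \<eta>" "0 < A" "0 < C"
    and good: "\<And>h y. 0 < h \<Longrightarrow> h < h0 \<Longrightarrow> y \<in> K \<Longrightarrow> good_turn \<eta> A B C h y"
    and small: "h0 * C < \<kappa> - 1" and start: "0 < h" "h < h0" "y \<in> K"
begin

abbreviation "hs i \<equiv> fst (turn h y i)"
abbreviation "ys i \<equiv> snd (turn h y i)"
abbreviation "\<Gamma> i \<equiv> \<kappa> + hs i * Y p (hs i) (ys i) 0"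

lemma turn_growth_gt_1:
  assumes "0 < g" "g < h0" "z \<in> K"
  shows "1 < \<kappa> + g * Y p g z 0"
proof -
  have "\<bar>g * Y p g z 0\<bar> \<le> g * C"
    using good[OF assms] assms(1) by (simp add: good_turn_def abs_mult)
  also have "\<dots> < h0 * C" using assms(2) pos(3) by simp
  finally show ?thesis using small by linarith
qed

lemma turn_in_trap: "0 < hs i \<and> hs i < h0 \<and> ys i \<in> K"
proof (induction i)
  case (Suc i)
  then have growth: "1 < \<Gamma> i" by (intro turn_growth_gt_1) auto
  then have "hs i / \<Gamma> i < hs i" "0 < hs i / \<Gamma> i" using Suc by (auto simp: divide_less_eq)
  moreover have "return_map (hs i) (ys i) \<in> K" using Suc good[of "hs i" "ys i"] by (simp add: good_turn_def)
  ultimately show ?case using Suc by (simp add: split_beta)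
qed (simp add: start)

lemma good_turn_turn: "good_turn \<eta> A B C (hs i) (ys i)"
  using turn_in_trap good by blast

lemma hs_growth:
  obtains a b where "0 < a" "\<And>i. a \<le> \<kappa> ^ i * hs i" "\<And>i. \<kappa> ^ i * hs i \<le> b"
proof -
  define m where "m = C / (\<kappa> - 1)"
  have \<kappa>: "1 < \<kappa>" by (rule growth(2))
  have "1 / hs (Suc i) = \<kappa> * (1 / hs i) + Y p (hs i) (ys i) 0" for i
    using turn_in_trap[of i] turn_growth_gt_1[of "hs i" "ys i"] by (simp add: split_beta add_divide_distrib)
  then have "\<bar>1 / hs (Suc i) - \<kappa> * (1 / hs i)\<bar> \<le> C" for i
    using good_turn_turn[of i] by (simp add: good_turn_def)
  from perturbed_geometric[of \<kappa> "\<lambda>i. 1 / hs i", OF \<kappa> this]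
  have s: "\<kappa> ^ i * (1 / h - m) \<le> 1 / hs i - m" "1 / hs i + m \<le> \<kappa> ^ i * (1 / h + m)" for i
    by (simp_all add: m_def)
  have "0 < m" using pos(3) \<kappa> by (simp add: m_def)
  have "h * C < \<kappa> - 1"
    using mult_strict_right_mono[OF start(2) pos(3)] small by simp
  then have "m < 1 / h" using start(1) \<kappa> by (simp add: m_def field_simps)
  have "0 < 1 / h + m" using start(1) \<open>0 < m\<close> by (simp add: add_pos_pos)
  show ?thesis
  proof (rule that[of "1 / (1 / h + m)" "1 / (1 / h - m)"])
    show "0 < 1 / (1 / h + m)" using \<open>0 < 1 / h + m\<close> by simp
    fix i
    have "0 < hs i" using turn_in_trap by simp
    have "1 / hs i \<le> \<kappa> ^ i * (1 / h + m)" using s(2)[of i] \<open>0 < m\<close> by simp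
    then show "1 / (1 / h + m) \<le> \<kappa> ^ i * hs i"
      using \<open>0 < hs i\<close> \<open>0 < 1 / h + m\<close> by (simp add: divide_le_eq mult_ac)
    have "\<kappa> ^ i * (1 / h - m) \<le> 1 / hs i" using s(1)[of i] \<open>0 < m\<close> by simp
    then show "\<kappa> ^ i * hs i \<le> 1 / (1 / h - m)"
      using \<open>0 < hs i\<close> \<open>m < 1 / h\<close> by (simp add: le_divide_eq mult_ac)
  qed
qed

lemma orbit_eq: "orbit h y k = X (k mod p) (hs (k div p)) (ys (k div p))"
  by (simp add: orbit_def split_beta)

lemma orbit_selects: "selects n c (orbit h y k) (js (k mod p))"
  using good_turn_turn[of "k div p"] p_pos by (simp add: orbit_eq good_turn_def)

lemma orbit_Suc:
  obtains s where "s \<noteq> 0" "quad_step n c (js (k mod p)) (orbit h y k) = (\<lambda>i. s * orbit h y (Suc k) i)"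
proof -
  define t i where "t = k mod p" and "i = k div p"
  have "t < p" using p_pos by (simp add: t_def)
  moreover have "L (X t (hs i) (ys i)) (js t) \<noteq> 0"
    using orbit_selects[of k] by (auto simp: orbit_eq t_def i_def selects_def)
  ultimately have step: "quad_step n c (js t) (orbit h y k) = X (Suc t) (hs i) (ys i)"
    unfolding orbit_eq t_def[symmetric] i_def[symmetric] by (rule quad_step_X)
  show ?thesis
  proof (cases "Suc t = p")
    case True
    then have "orbit h y (Suc k) = X 0 (hs (Suc i)) (ys (Suc i))"
      by (simp add: orbit_eq t_def i_def mod_Suc div_Suc)
    moreover have "1 < \<Gamma> i" using turn_in_trap by (intro turn_growth_gt_1) auto
    ultimately show ?thesis
      using step X_p[of "hs i" "ys i"]
      by (intro that[of "\<Gamma> i"]) (simp_all add: True split_beta flip: t_def)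
  next
    case False
    then have "orbit h y (Suc k) = X (Suc t) (hs i) (ys i)"
      using \<open>t < p\<close> by (simp add: orbit_eq t_def i_def mod_Suc div_Suc)
    then show ?thesis using step by (intro that[of 1]) (auto simp: t_def)
  qed
qed

lemma quad_orbit_orbit: "quad_orbit n c (orbit h y) (\<lambda>k. js (k mod p))"
  unfolding quad_orbit_def using orbit_selects orbit_Suc js_less p_pos by (metis mod_less_divisor)

lemma bursts_orbit: "bursts \<alpha> \<kappa> p (\<lambda>k. quad_edge n c (orbit h y k) (js (k mod p)))"
  unfolding bursts_def
proof (intro conjI)
  show "0 < p" "1 < \<kappa>" by (rule p_pos, rule growth(2))
  have "\<alpha> + \<eta> \<le> quad_edge n c (orbit h y k) (js (k mod p))" if "\<not> p dvd k" for k
    using that good_turn_turn[of "k div p"] p_pos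
    by (simp add: orbit_eq good_turn_def mod_greater_zero_iff_not_dvd)
  then show "\<exists>\<eta>>0. \<forall>k. \<not> p dvd k \<longrightarrow> \<alpha> + \<eta> \<le> quad_edge n c (orbit h y k) (js (k mod p))"
    using pos(1) by blast
  define e where "e i = quad_edge n c (orbit h y (p * i)) (js (p * i mod p)) - \<alpha>" for i
  have e: "A * hs i \<le> e i" "e i \<le> B * hs i" for i
    using good_turn_turn[of i] p_pos by (auto simp: e_def orbit_eq good_turn_def)
  obtain a b where a: "0 < a" "\<And>i. a \<le> \<kappa> ^ i * hs i" and b: "\<And>i. \<kappa> ^ i * hs i \<le> b"
    using hs_growth by blast
  have "0 < A * h" using pos(2) start(1) by simp
  also have "\<dots> \<le> B * h" using e[of 0] by simp
  finally have "0 \<le> B" using start(1) by (simp add: zero_less_mult_iff)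
  have "A * a \<le> \<kappa> ^ i * e i \<and> \<kappa> ^ i * e i \<le> B * b" for i
  proof
    have "0 < \<kappa> ^ i" using growth(2) by simp
    have "A * a \<le> A * (\<kappa> ^ i * hs i)" using a(2) pos(2) by simp
    also have "\<dots> \<le> \<kappa> ^ i * e i" using e(1)[of i] \<open>0 < \<kappa> ^ i\<close> by (simp add: mult.left_commute)
    finally show "A * a \<le> \<kappa> ^ i * e i" .
    have "\<kappa> ^ i * e i \<le> B * (\<kappa> ^ i * hs i)" using e(2)[of i] \<open>0 < \<kappa> ^ i\<close> by (simp add: mult.left_commute)
    also have "\<dots> \<le> B * b" using b \<open>0 \<le> B\<close> by (intro mult_left_mono)
    finally show "\<kappa> ^ i * e i \<le> B * b" .
  qed
  moreover have "0 < A * a" using pos(2) a(1) by simp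
  ultimately show "\<exists>A>0. \<exists>B. \<forall>i. A \<le> \<kappa> ^ i * (quad_edge n c (orbit h y (p * i)) (js (p * i mod p)) - \<alpha>) \<and>
      \<kappa> ^ i * (quad_edge n c (orbit h y (p * i)) (js (p * i mod p)) - \<alpha>) \<le> B"
    unfolding e_def by blast
qed

end

theorem (in trapped_cycle) eventually_orbit_bursts:
  "\<forall>\<^sub>F h in at_right 0. \<forall>y\<in>K. quad_orbit n c (orbit h y) (\<lambda>k. js (k mod p)) \<and>
     bursts \<alpha> \<kappa> p (\<lambda>k. quad_edge n c (orbit h y k) (js (k mod p)))"
proof -
  obtain \<eta> A B C where pos: "0 < \<eta>" "0 < A" "0 < C"
    and good: "\<forall>\<^sub>F h in at_right 0. \<forall>y\<in>K. good_turn \<eta> A B C h y"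
    by (rule eventually_good_turn)
  then obtain h1 where h1: "0 < h1" "\<And>h y. 0 < h \<Longrightarrow> h < h1 \<Longrightarrow> y \<in> K \<Longrightarrow> good_turn \<eta> A B C h y"
    unfolding eventually_at_right_field by blast
  define h0 where "h0 = min h1 ((\<kappa> - 1) / (2 * C))"
  have "0 < h0" using h1(1) pos(3) growth(2) by (simp add: h0_def)
  have "h0 * C \<le> (\<kappa> - 1) / (2 * C) * C" using pos(3) by (intro mult_right_mono) (auto simp: h0_def)
  also have "\<dots> < \<kappa> - 1" using pos(3) growth(2) by simp
  finally have "h0 * C < \<kappa> - 1" .
  have "quad_orbit n c (orbit h y) (\<lambda>k. js (k mod p)) \<and>
      bursts \<alpha> \<kappa> p (\<lambda>k. quad_edge n c (orbit h y k) (js (k mod p)))" if "0 < h" "h < h0" "y \<in> K" for h y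
  proof -
    interpret good_start n c p js W \<kappa> \<alpha> K \<eta> A B C h0 h y
      using that pos h1(2) \<open>h0 * C < \<kappa> - 1\<close> by unfold_locales (auto simp: h0_def)
    show ?thesis using quad_orbit_orbit bursts_orbit ..
  qed
  then show ?thesis
    unfolding eventually_at_right_field using \<open>0 < h0\<close> by blast
qed

lemma (in trapped_cycle) orbit_0_pos:
  assumes "y \<in> K" "0 < h" "quad_orbit n c (orbit h y) J" "a \<le> n"
  shows "0 < orbit h y 0 a"
proof (cases "a = n")
  case True
  then show ?thesis using assms(1,2) K_normalized by (auto simp: orbit_0 X_def V_0 normalized_def)
next
  case False
  then show ?thesis using assms(3,4) by (simp add: quad_orbit_def selects_def)
qed

theorem (in trapped_cycle) sign_matrix_realisation:
  assumes n: "2 \<le> n" and complete: "\<And>a b. a < n \<Longrightarrow> b < n \<Longrightarrow> a \<noteq> b \<Longrightarrow> 0 < c a b"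
    and y: "y \<in> K" "\<And>k. k \<le> n \<Longrightarrow> y k \<in> \<int>" and \<alpha>: "0 < \<alpha>"
  obtains m M where "regular_run m n M" "margin m n M = 1 - 4 / n"
    "bursts \<alpha> \<kappa> p (\<lambda>k. top_edge m n M (ada_iter m n M k))"
proof -
  obtain h0 where h0: "0 < h0" and orbits: "\<And>h. 0 < h \<Longrightarrow> h < h0 \<Longrightarrow>
      quad_orbit n c (orbit h y) (\<lambda>k. js (k mod p)) \<and>
      bursts \<alpha> \<kappa> p (\<lambda>k. quad_edge n c (orbit h y k) (js (k mod p)))"
    using eventually_orbit_bursts y(1) unfolding eventually_at_right_field by blast
  obtain S :: nat where S: "1 / h0 < S" using reals_Archimedean2 by blast
  then have "0 < real S" using h0 by (meson divide_pos_pos less_trans zero_less_one)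
  moreover have "1 / S < h0" using S h0 \<open>0 < real S\<close> by (simp add: field_simps)
  ultimately have orbit: "quad_orbit n c (orbit (1 / S) y) (\<lambda>k. js (k mod p))"
    and bursts: "bursts \<alpha> \<kappa> p (\<lambda>k. quad_edge n c (orbit (1 / S) y k) (js (k mod p)))"
    using orbits[of "1 / S"] by auto
  define w where "w a = nat \<lfloor>S * orbit (1 / S) y 0 a\<rfloor>" for a
  have "S * orbit (1 / S) y 0 a = S * V 0 a + y a" for a
    using \<open>0 < real S\<close> by (simp add: orbit_0 X_def distrib_left)
  then have int: "S * orbit (1 / S) y 0 a \<in> \<int>" if "a \<le> n" for a
    using y(2)[OF that] by (simp add: V_0)
  have pos: "0 < orbit (1 / S) y 0 a" if "a \<le> n" for a
    using orbit_0_pos[OF y(1) _ orbit that] \<open>0 < real S\<close> by simp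
  have w: "S * orbit (1 / S) y 0 a = real (w a)" if "a \<le> n" for a
    using int[OF that] pos[OF that] by (auto simp: w_def elim!: Ints_cases)
  have w_pos: "0 < w a" if "a \<le> n" for a
    using w[OF that] pos[OF that] \<open>0 < real S\<close> by (metis mult_pos_pos of_nat_0_less_iff)
  have edge_pos: "0 < quad_edge n c (orbit (1 / S) y k) (js (k mod p))" for k
    using bursts_gt[OF bursts] \<alpha> less_trans by blast
  have "real S \<noteq> 0" using \<open>0 < real S\<close> by simp
  with orbit edge_pos obtain m M where "regular_run m n M" "margin m n M = 1 - 4 / n"
    "(\<lambda>k. top_edge m n M (ada_iter m n M k)) = (\<lambda>k. quad_edge n c (orbit (1 / S) y k) (js (k mod p)))"
    using w w_pos n complete by (rule quad_orbit_realisation)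
  then show ?thesis using bursts by (intro that[of m M]) auto
qed

section \<open>Enclosures of the return map\<close>

definition perturb_coef :: "nat \<Rightarrow> (nat \<Rightarrow> nat \<Rightarrow> nat) \<Rightarrow> (nat \<Rightarrow> real) \<Rightarrow> real \<Rightarrow> nat \<Rightarrow> nat \<Rightarrow> real" where
  "perturb_coef n c V W j k = (if k = j then 0 else lin_form n c V k - (V j + W) * c j k)"

lemma (in pair_weights) perturb_step_0:
  assumes "j \<le> n"
  shows "perturb_step n c V W j 0 y = (\<Sum>k\<le>n. perturb_coef n c V W j k * y k) / L V j"
proof -
  have "(\<Sum>k\<le>n. perturb_coef n c V W j k * y k)
      = (\<Sum>k\<le>n. L V k * y k - (V j + W) * (c j k * y k) - (if k = j then L V j * y j else 0))"
    using assms weight_diag by (intro sum.cong) (auto simp: perturb_coef_def algebra_simps)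
  also have "\<dots> = polar_form n c V y - (V j + W) * L y j - L V j * y j"
    using assms by (simp add: sum_subtractf polar_form_def lin_form_def[of n c y] sum_distrib_left)
  finally show ?thesis by (simp add: perturb_step_def algebra_simps)
qed

lemma abs_linear_enclosure_le:
  fixes z :: "'a \<Rightarrow> real" and s :: "'b \<Rightarrow> real"
  assumes s: "\<And>i. i \<in> I \<Longrightarrow> \<bar>s i\<bar> \<le> 1" and z: "\<And>k. k \<in> A \<Longrightarrow> \<bar>z k - (\<Sum>i\<in>I. H k i * s i)\<bar> \<le> e k"
  shows "\<bar>(\<Sum>k\<in>A. a k * z k) - (\<Sum>i\<in>I. g i * s i)\<bar>
    \<le> (\<Sum>i\<in>I. \<bar>(\<Sum>k\<in>A. a k * H k i) - g i\<bar>) + (\<Sum>k\<in>A. \<bar>a k\<bar> * e k)"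
proof -
  have "(\<Sum>k\<in>A. a k * (\<Sum>i\<in>I. H k i * s i)) = (\<Sum>i\<in>I. (\<Sum>k\<in>A. a k * H k i) * s i)"
    unfolding sum_distrib_left sum_distrib_right by (subst sum.swap) (simp add: mult_ac)
  then have "(\<Sum>k\<in>A. a k * z k) - (\<Sum>i\<in>I. g i * s i)
      = (\<Sum>i\<in>I. ((\<Sum>k\<in>A. a k * H k i) - g i) * s i) + (\<Sum>k\<in>A. a k * (z k - (\<Sum>i\<in>I. H k i * s i)))"
    by (simp add: right_diff_distrib left_diff_distrib sum_subtractf)
  also have "\<bar>\<dots>\<bar> \<le> (\<Sum>i\<in>I. \<bar>((\<Sum>k\<in>A. a k * H k i) - g i) * s i\<bar>)
      + (\<Sum>k\<in>A. \<bar>a k * (z k - (\<Sum>i\<in>I. H k i * s i))\<bar>)"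
    by (intro order_trans[OF abs_triangle_ineq] add_mono sum_abs)
  also have "\<dots> \<le> (\<Sum>i\<in>I. \<bar>(\<Sum>k\<in>A. a k * H k i) - g i\<bar>) + (\<Sum>k\<in>A. \<bar>a k\<bar> * e k)"
    using s z by (intro add_mono sum_mono) (auto simp: abs_mult intro: mult_left_mono mult_left_le)
  finally show ?thesis .
qed

text \<open>Composing the \<open>p\<close> affine steps at \<open>h = 0\<close> exactly would produce huge fractions. Instead, coordinate \<open>k\<close>
  of the image of a perturbation \<open>y\<close> after \<open>t\<close> steps is enclosed in
  \<open>(\<Sum>i<n. G t k i * coord y i) \<plusminus> E t k\<close> with rounded \<open>G\<close>.\<close>

locale enclosure_data = quad_cycle +
  fixes f :: "nat \<Rightarrow> nat \<Rightarrow> real" and r :: "nat \<Rightarrow> real"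
    and G0 G_new :: "nat \<Rightarrow> nat \<Rightarrow> real" and E_new :: "nat \<Rightarrow> real"
begin

abbreviation "G \<equiv> updates G0 js G_new"
abbreviation "E \<equiv> updates (\<lambda>_. 0) js E_new"

definition coord :: "(nat \<Rightarrow> real) \<Rightarrow> nat \<Rightarrow> real" where
  "coord y i = (\<Sum>k\<le>n. f i k * y k) / r i"

definition trap :: "(nat \<Rightarrow> real) set" where
  "trap = {y \<in> normalized n. \<forall>i<n - 1. \<bar>\<Sum>k\<le>n. f i k * y k\<bar> \<le> r i}"

definition drift_coef :: "nat \<Rightarrow> real" where
  "drift_coef k = 2 * (1 - \<alpha>) * L (V 0) k
     - 4 * ((if k = js 0 then L (V 0) (js 0) else 0) + V 0 (js 0) * c (js 0) k)"

definition step_residual :: "nat \<Rightarrow> real" where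
  "step_residual t =
     (\<Sum>i<n. \<bar>(\<Sum>k\<le>n. perturb_coef n c (V t) (W t) (js t) k * G t k i) - L (V t) (js t) * G_new t i\<bar>)
       + (\<Sum>k\<le>n. \<bar>perturb_coef n c (V t) (W t) (js t) k\<bar> * E t k)"

definition return_bound :: "nat \<Rightarrow> real" where
  "return_bound i =
     (\<Sum>l<n. \<bar>\<Sum>k\<le>n. f i k * (G p k l - V 0 k * G p 0 l)\<bar>)
       + (\<Sum>k\<le>n. \<bar>f i k\<bar> * (E p k + V 0 k * E p 0))"

end

locale certified_cycle = enclosure_data +
  assumes r_pos: "\<And>i. i < n \<Longrightarrow> 0 < r i"
    and last_coordinate: "r (n - 1) = 1" "\<And>k. k \<le> n \<Longrightarrow> f (n - 1) k = (if k = n then 1 else 0)"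
    and G0_inverse: "\<And>k l. k \<le> n \<Longrightarrow> 0 < l \<Longrightarrow> l \<le> n \<Longrightarrow>
      (\<Sum>i<n. G0 k i / r i * f i l) = (if k = l then 1 else 0)"
    and step_enclosure: "\<And>t. t < p \<Longrightarrow> step_residual t \<le> L (V t) (js t) * E_new t"
    and contraction: "\<And>i. i < n - 1 \<Longrightarrow> return_bound i < r i"
    and drift_dominates: "(\<Sum>i<n - 1. \<bar>\<Sum>k\<le>n. drift_coef k * G0 k i\<bar>)
      < (\<Sum>k\<le>n. drift_coef k * G0 k (n - 1))"
begin

lemma coord_last: "y \<in> normalized n \<Longrightarrow> coord y (n - 1) = 1"
  using last_coordinate by (simp add: coord_def normalized_def if_distrib[of "\<lambda>x. x * _"]
      cong: if_cong sum.cong_simp del: One_nat_def)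

lemma abs_coord_le: "y \<in> trap \<Longrightarrow> i < n \<Longrightarrow> \<bar>coord y i\<bar> \<le> 1"
  using coord_last[of y] r_pos[of i] by (cases "i = n - 1") (auto simp: trap_def coord_def)

lemma normalized_eq_sum:
  assumes "y \<in> normalized n" "k \<le> n"
  shows "y k = (\<Sum>i<n. G0 k i * coord y i)"
proof -
  have "(\<Sum>i<n. G0 k i * coord y i) = (\<Sum>i<n. \<Sum>l\<le>n. G0 k i / r i * f i l * y l)"
    by (simp add: coord_def sum_distrib_left sum_divide_distrib mult_ac)
  also have "\<dots> = (\<Sum>l\<le>n. (\<Sum>i<n. G0 k i / r i * f i l) * y l)"
    unfolding sum_distrib_right by (rule sum.swap)
  also have "\<dots> = (\<Sum>l\<le>n. if k = l then y l else 0)"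
  proof (rule sum.cong[OF refl])
    fix l assume "l \<in> {..n}"
    then show "(\<Sum>i<n. G0 k i / r i * f i l) * y l = (if k = l then y l else 0)"
      using assms G0_inverse[of k l] by (cases "l = 0") (auto simp: normalized_def)
  qed
  finally show ?thesis using assms(2) by simp
qed

lemma Y_enclosure:
  assumes y: "y \<in> trap"
  shows "t \<le> p \<Longrightarrow> k \<le> n \<Longrightarrow> \<bar>Y t 0 y k - (\<Sum>i<n. G t k i * coord y i)\<bar> \<le> E t k"
proof (induction t arbitrary: k)
  case 0
  then show ?case using normalized_eq_sum[of y k] y by (simp add: trap_def)
next
  case (Suc t)
  then have t: "t < p" by simp
  show ?case
  proof (cases "k = js t")
    case True
    let ?a = "perturb_coef n c (V t) (W t) (js t)" and ?l = "L (V t) (js t)"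
    have Y: "?l * Y (Suc t) 0 y k = (\<Sum>k\<le>n. ?a k * Y t 0 y k)"
      using L_pos[OF t] js_less[OF t] True by (simp add: perturb_step_0)
    have "?l * \<bar>Y (Suc t) 0 y k - (\<Sum>i<n. G_new t i * coord y i)\<bar>
        = \<bar>?l * (Y (Suc t) 0 y k - (\<Sum>i<n. G_new t i * coord y i))\<bar>"
      using L_pos[OF t] by (simp only: abs_mult abs_of_pos)
    also have "\<dots> = \<bar>(\<Sum>k\<le>n. ?a k * Y t 0 y k) - (\<Sum>i<n. ?l * G_new t i * coord y i)\<bar>"
      by (simp only: Y right_diff_distrib sum_distrib_left mult.assoc)
    also have "\<dots> \<le> (\<Sum>i<n. \<bar>(\<Sum>k\<le>n. ?a k * G t k i) - ?l * G_new t i\<bar>) + (\<Sum>k\<le>n. \<bar>?a k\<bar> * E t k)"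
      using Suc.IH t abs_coord_le[OF y] by (intro abs_linear_enclosure_le) auto
    also have "\<dots> \<le> ?l * E_new t" using step_enclosure[OF t] by (simp add: step_residual_def)
    finally show ?thesis using L_pos[OF t] True by simp
  next
    case False
    then show ?thesis using Suc by simp
  qed
qed

lemma return_map_contracts:
  assumes y: "y \<in> trap" and i: "i < n - 1"
  shows "\<bar>\<Sum>k\<le>n. f i k * return_map 0 y k\<bar> < r i"
proof -
  have "\<bar>return_map 0 y k - (\<Sum>l<n. (G p k l - V 0 k * G p 0 l) * coord y l)\<bar> \<le> E p k + V 0 k * E p 0"
    if "k \<le> n" for k
  proof -
    have "\<bar>Y p 0 y k - (\<Sum>l<n. G p k l * coord y l)\<bar> \<le> E p k"
      and "V 0 k * \<bar>Y p 0 y 0 - (\<Sum>l<n. G p 0 l * coord y l)\<bar> \<le> V 0 k * E p 0"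
      using Y_enclosure[OF y order_refl] that by (auto simp: V_0)
    then show ?thesis
      by (auto simp: return_map_def left_diff_distrib sum_subtractf V_0 split: if_splits)
  qed
  then have "\<bar>(\<Sum>k\<le>n. f i k * return_map 0 y k) - (\<Sum>l<n. 0 * coord y l)\<bar>
      \<le> (\<Sum>l<n. \<bar>(\<Sum>k\<le>n. f i k * (G p k l - V 0 k * G p 0 l)) - 0\<bar>)
        + (\<Sum>k\<le>n. \<bar>f i k\<bar> * (E p k + V 0 k * E p 0))"
    using abs_coord_le[OF y] by (intro abs_linear_enclosure_le) auto
  then show ?thesis using contraction[OF i] by (simp add: return_bound_def)
qed

lemma drift_eq_sum: "drift y = (\<Sum>k\<le>n. drift_coef k * y k)"
proof -
  let ?j = "js 0"
  have "(\<Sum>k\<le>n. drift_coef k * y k) = (\<Sum>k\<le>n. 2 * (1 - \<alpha>) * (L (V 0) k * y k)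
      - 4 * (if k = ?j then L (V 0) ?j * y ?j else 0) - 4 * V 0 ?j * (c ?j k * y k))"
    by (intro sum.cong) (auto simp: drift_coef_def algebra_simps)
  also have "\<dots> = 2 * (1 - \<alpha>) * polar_form n c (V 0) y - 4 * (L (V 0) ?j * y ?j) - 4 * V 0 ?j * L y ?j"
    using js_less[OF p_pos]
    by (simp add: sum_subtractf polar_form_def lin_form_def[of n c y] flip: sum_distrib_left)
  finally show ?thesis by (simp add: drift_def)
qed

lemma drift_pos:
  assumes "y \<in> trap"
  shows "0 < drift y"
proof -
  have y: "y \<in> normalized n" using assms by (simp add: trap_def)
  let ?d = "\<lambda>i. \<Sum>k\<le>n. drift_coef k * G0 k i"
  have "drift y = (\<Sum>k\<le>n. drift_coef k * y k)"
    by (rule drift_eq_sum)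
  also have "\<dots> = (\<Sum>k\<le>n. drift_coef k * (\<Sum>i<n. G0 k i * coord y i))"
    by (intro sum.cong) (simp_all add: normalized_eq_sum[OF y, symmetric])
  also have "\<dots> = (\<Sum>i<n. ?d i * coord y i)"
    unfolding sum_distrib_left sum_distrib_right by (subst sum.swap) (simp add: mult_ac)
  also have "\<dots> = ?d (n - 1) + (\<Sum>i<n - 1. ?d i * coord y i)"
    using n_pos coord_last[OF y] sum.lessThan_Suc[of "\<lambda>i. ?d i * coord y i" "n - 1"] by simp
  finally have "drift y = ?d (n - 1) + (\<Sum>i<n - 1. ?d i * coord y i)" .
  moreover have "\<bar>\<Sum>i<n - 1. ?d i * coord y i\<bar> \<le> (\<Sum>i<n - 1. \<bar>?d i\<bar>)"
    using abs_coord_le[OF assms]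
    by (intro order_trans[OF sum_abs] sum_mono) (auto simp: abs_mult intro: mult_left_le)
  ultimately show ?thesis using drift_dominates by linarith
qed

lemma compact_trap: "compact trap"
proof -
  define B where "B k = (if k \<le> n then \<Sum>i<n. \<bar>G0 k i\<bar> else 0)" for k
  have "trap \<subseteq> Pi\<^sub>E UNIV (\<lambda>k. {- B k..B k})"
  proof (clarsimp simp: PiE_UNIV_domain)
    fix y k assume y: "y \<in> trap"
    show "- B k \<le> y k \<and> y k \<le> B k"
    proof (cases "k \<le> n")
      case True
      have "\<bar>y k\<bar> \<le> (\<Sum>i<n. \<bar>G0 k i\<bar>)"
        unfolding normalized_eq_sum[OF _ True, of y] using y abs_coord_le[OF y]
        by (subst normalized_eq_sum[OF _ True])
           (auto simp: trap_def abs_mult intro!: order_trans[OF sum_abs] sum_mono mult_left_le)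
      then show ?thesis using True by (simp add: B_def abs_le_iff)
    qed (use y in \<open>simp add: B_def trap_def normalized_def\<close>)
  qed
  moreover have "compact (Pi\<^sub>E UNIV (\<lambda>k. {- B k..B k}))"
    using compactin_PiE[of "\<lambda>_. euclidean" UNIV "\<lambda>k. {- B k..B k}"]
    by (simp add: euclidean_product_topology)
  moreover have "closed trap"
    unfolding trap_def normalized_def mem_Collect_eq
    by (intro closed_Collect_conj closed_Collect_all closed_Collect_imp closed_Collect_eq closed_Collect_le
        continuous_intros continuous_on_product_coordinates) auto
  ultimately show ?thesis by (metis compact_Int_closed inf.absorb_iff2)
qed

sublocale trapped_cycle n c p js W \<kappa> \<alpha> trap
proof
  show "compact trap" by (rule compact_trap)
  show "trap \<subseteq> normalized n" by (auto simp: trap_def)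
  show "0 < drift y" if "y \<in> trap" for y using that by (rule drift_pos)
  fix y assume "y \<in> trap"
  have "\<forall>\<^sub>F z in nhds (return_map 0 y). \<forall>i\<in>{..<n - 1}. \<bar>\<Sum>k\<le>n. f i k * z k\<bar> < r i"
  proof (intro eventually_ball_finite ballI)
    fix i assume "i \<in> {..<n - 1}"
    have "((\<lambda>z. z) \<longlongrightarrow> return_map 0 y) (nhds (return_map 0 y))" by (rule filterlim_ident)
    then have "((\<lambda>z. \<bar>\<Sum>k\<le>n. f i k * z k\<bar>) \<longlongrightarrow> \<bar>\<Sum>k\<le>n. f i k * return_map 0 y k\<bar>) (nhds (return_map 0 y))"
      unfolding tendsto_fun_iff by (intro tendsto_intros) auto
    then show "\<forall>\<^sub>F z in nhds (return_map 0 y). \<bar>\<Sum>k\<le>n. f i k * z k\<bar> < r i"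
      using return_map_contracts[OF \<open>y \<in> trap\<close>] \<open>i \<in> {..<n - 1}\<close> by (intro order_tendstoD(2)) auto
  qed simp
  then show "\<forall>\<^sub>F z in nhds (return_map 0 y). z \<in> normalized n \<longrightarrow> z \<in> trap"
    by (rule eventually_mono) (auto simp: trap_def less_imp_le)
qed

end

section \<open>Two explicit cycles\<close>

lemma less_5_iff: "k < (5 :: nat) \<longleftrightarrow> k = 0 \<or> k = 1 \<or> k = 2 \<or> k = 3 \<or> k = 4"
  and le_5_iff: "k \<le> (5 :: nat) \<longleftrightarrow> k = 0 \<or> k = 1 \<or> k = 2 \<or> k = 3 \<or> k = 4 \<or> k = 5"
  and less_10_iff: "t < (10 :: nat) \<longleftrightarrow>
    t = 0 \<or> t = 1 \<or> t = 2 \<or> t = 3 \<or> t = 4 \<or> t = 5 \<or> t = 6 \<or> t = 7 \<or> t = 8 \<or> t = 9"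
  by auto

lemma sum_less_4: "(\<Sum>k<4. f k) = f 0 + f 1 + f 2 + f (3 :: nat)"
  and sum_less_5: "(\<Sum>k<5. f k) = f 0 + f 1 + f 2 + f 3 + f (4 :: nat)"
  and sum_le_5: "(\<Sum>k\<le>5. f k) = f 0 + f 1 + f 2 + f 3 + f 4 + f (5 :: nat)"
  by (simp_all add: numeral_eq_Suc)

lemmas expand_sums = sum_less_4 sum_less_5 sum_le_5

lemma updates_eval:
  "updates f js w 0 k = f k"
  "updates f js w (numeral m) k =
    (if k = js (pred_numeral m) then w (pred_numeral m) else updates f js w (pred_numeral m) k)"
  by (simp_all add: numeral_eq_Suc)

definition entry :: "'a list list \<Rightarrow> nat \<Rightarrow> nat \<Rightarrow> 'a" where
  "entry T a b = T ! a ! b"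

definition triangle :: "nat list list \<Rightarrow> nat \<Rightarrow> nat \<Rightarrow> nat" where
  "triangle T a b = (if a < b then entry T a (b - a - 1) else if b < a then entry T b (a - b - 1) else 0)"

lemma pair_weights_triangle: "pair_weights n (triangle T)"
  by unfold_locales (auto simp: triangle_def)

lemma entry_Cons:
  "entry (xs # T) 0 b = xs ! b" "entry (xs # T) (Suc a) b = entry T a b"
  "entry (xs # T) (numeral m) b = entry T (pred_numeral m) b"
  by (simp_all add: entry_def)

text \<open>These congruence rules keep the simplifier from traversing the tables at each lookup.\<close>

lemma lookup_cong [cong]:
  "a = a' \<Longrightarrow> xs ! a = xs ! a'" "a = a' \<Longrightarrow> b = b' \<Longrightarrow> entry T a b = entry T a' b'"
  "a = a' \<Longrightarrow> b = b' \<Longrightarrow> triangle U a b = triangle U a' b'"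
  "a = a' \<Longrightarrow> b = b' \<Longrightarrow> updates f js w a b = updates f js w a' b'"
  "a = a' \<Longrightarrow> b = b' \<Longrightarrow> cycle_data.V n js W a b = cycle_data.V n js W a' b'"
  by simp_all

text \<open>Let \<open>R t\<close> be the ratio of the values of the updated coordinate after and before step \<open>t\<close>. A step
  multiplies the quadratic form by \<open>2 * R t / (1 + R t)\<close>, so the ratios are chosen rational such that the
  product of these factors is \<open>\<kappa>\<^sup>2\<close>; the ten balance equations, linear in the ten weights of pairs below
  \<open>5\<close>, then have a one-dimensional solution space. The smallest ratio \<open>R 0 = 21/11\<close> gives the edge \<open>5/16\<close>.
  The weight of the pair \<open>{0, 5}\<close> of the dummy coordinate is so large that the box of perturbations below
  contains integral points.\<close>

datatype factor = Left | Right

primrec growth :: "factor \<Rightarrow> real" where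
  "growth Left = 5"
| "growth Right = 56/11"

primrec cycle_weight :: "factor \<Rightarrow> nat \<Rightarrow> nat \<Rightarrow> nat" where
  "cycle_weight Left = triangle
    [[2763591864, 8223372828, 46526640900, 103540295592, 200000000000000],
     [49721568061, 106288516619, 9117109104, 0],
     [20736529632, 119625109800, 0],
     [1977705408, 0],
     [0]]"
| "cycle_weight Right = triangle
    [[1057811147822, 6415527252684, 735536885421, 15685065942923, 10000000000000000],
     [4989965937066, 9136491638625, 11223508367877, 0],
     [12419490743982, 2052113019600, 0],
     [5794136275200, 0],
     [0]]"

primrec cycle_column :: "factor \<Rightarrow> nat \<Rightarrow> nat" where
  "cycle_column Left = nth [0, 1, 2, 0, 3, 2, 4, 3, 1, 4]"
| "cycle_column Right = nth [0, 1, 2, 3, 0, 1, 4, 3, 2, 4]"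

primrec cycle_state :: "factor \<Rightarrow> nat \<Rightarrow> nat \<Rightarrow> real" where
  "cycle_state Left = entry
    [[1, 1, 1, 1, 1, 0],
     [21/11, 1, 1, 1, 1, 0],
     [21/11, 60/23, 1, 1, 1, 0],
     [21/11, 60/23, 19/9, 1, 1, 0],
     [5, 60/23, 19/9, 1, 1, 0],
     [5, 60/23, 19/9, 15/7, 1, 0],
     [5, 60/23, 5, 15/7, 1, 0],
     [5, 60/23, 5, 15/7, 160/83, 0],
     [5, 60/23, 5, 5, 160/83, 0],
     [5, 5, 5, 5, 160/83, 0],
     [5, 5, 5, 5, 5, 0]]"
| "cycle_state Right = entry
    [[1, 1, 1, 1, 1, 0],
     [21/11, 1, 1, 1, 1, 0],
     [21/11, 7/3, 1, 1, 1, 0],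
     [21/11, 7/3, 1768/759, 1, 1, 0],
     [21/11, 7/3, 1768/759, 19/9, 1, 0],
     [56/11, 7/3, 1768/759, 19/9, 1, 0],
     [56/11, 56/11, 1768/759, 19/9, 1, 0],
     [56/11, 56/11, 1768/759, 19/9, 589/275, 0],
     [56/11, 56/11, 1768/759, 56/11, 589/275, 0],
     [56/11, 56/11, 56/11, 56/11, 589/275, 0],
     [56/11, 56/11, 56/11, 56/11, 56/11, 0]]"

definition cycle_value :: "factor \<Rightarrow> nat \<Rightarrow> real" where
  "cycle_value s t = cycle_state s (Suc t) (cycle_column s t)"

lemmas cycle_simps =
  entry_Cons cycle_weight.simps triangle_def cycle_column.simps cycle_state.simps cycle_value_def

interpretation F: cycle_data 5 "cycle_weight s" 10 "cycle_column s" "cycle_value s" for s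
  unfolding cycle_data_def by (cases s) (simp_all add: pair_weights_triangle)

lemma V_eq_cycle_state: "t \<le> 10 \<Longrightarrow> k \<le> 5 \<Longrightarrow> F.V s t k = cycle_state s t k"
proof (induction t)
  case 0
  have "cycle_state s 0 k = (if k < 5 then 1 else 0)"
    using \<open>k \<le> 5\<close> unfolding le_5_iff
    by (elim disjE; cases s; hypsubst) (simp_all add: cycle_simps)
  then show ?case by (simp add: F.V_0)
next
  case (Suc t)
  have "cycle_state s t k = cycle_state s (Suc t) k" if "t < 10" "k \<le> 5" "k \<noteq> cycle_column s t" for t k
    using that unfolding less_10_iff le_5_iff
    by (elim disjE; cases s; hypsubst) (simp_all add: cycle_simps)
  then show ?case using Suc by (simp add: F.V_Suc cycle_value_def[of s t])
qed

interpretation F: quad_cycle 5 "cycle_weight s" 10 "cycle_column s" "cycle_value s" "growth s" "5/16" for s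
proof
  show "cycle_column s t < 5" "0 < cycle_value s t" if "t < 10" for t
    using that unfolding less_10_iff
    by (elim disjE; cases s; hypsubst; simp add: cycle_simps)+
  have "cycle_state s 10 k = growth s" if "k < 5" for k
    using that unfolding less_5_iff
    by (elim disjE; cases s; hypsubst) (simp_all add: cycle_simps)
  then show "F.V s 10 k = growth s" if "k < 5" for k using that by (simp add: V_eq_cycle_state)
  show "F.Q s (F.V s t)
      = 2 * (F.V s t (cycle_column s t) + cycle_value s t) * F.L s (F.V s t) (cycle_column s t)"
    "0 < F.L s (F.V s t) (cycle_column s t)" if "t < 10" for t
    using that unfolding quad_form_def polar_form_def lin_form_def expand_sums less_10_iff
    by (elim disjE; cases s; hypsubst; simp add: V_eq_cycle_state cycle_simps)+
  show "F.V s t (cycle_column s t) * F.L s (F.V s t) (cycle_column s t) < F.V s t k * F.L s (F.V s t) k"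
    if "t < 10" "k < 5" "k \<noteq> cycle_column s t" for t k
    using that unfolding lin_form_def expand_sums less_10_iff less_5_iff
    by (elim disjE; cases s; hypsubst) (simp_all add: V_eq_cycle_state cycle_simps)
  show "(cycle_value s 0 - F.V s 0 (cycle_column s 0)) / (cycle_value s 0 + F.V s 0 (cycle_column s 0))
      = 5/16"
    by (cases s; simp add: V_eq_cycle_state cycle_simps)
  show "5/16
      < (cycle_value s t - F.V s t (cycle_column s t)) / (cycle_value s t + F.V s t (cycle_column s t))"
    if "0 < t" "t < 10" for t
    using that unfolding less_10_iff
    by (elim disjE; cases s; hypsubst) (simp_all add: V_eq_cycle_state cycle_simps)
qed (cases s; simp)+

text \<open>The box around an approximate fixed point of the return map at \<open>h = 0\<close>, with axes adapted to its
  linear part; \<open>step_image\<close> and \<open>step_error\<close> are rounded to integers.\<close>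

primrec trap_functional :: "factor \<Rightarrow> nat \<Rightarrow> nat \<Rightarrow> real" where
  "trap_functional Left = entry
    [[0, 0, 0, 1, -1, -3700],
     [0, 1, 0, 2, -3, 4600],
     [0, 0, 0, 0, 1, -19500],
     [0, 0, 1, -1, 0, 5400],
     [0, 0, 0, 0, 0, 1]]"
| "trap_functional Right = entry
    [[0, 0, 1, 0, 0, -6000],
     [0, 0, -1, 1, 0, 2200],
     [0, 0, -1, 0, 1, -400],
     [0, 1, -1, 0, 0, 1100],
     [0, 0, 0, 0, 0, 1]]"

primrec trap_radius :: "factor \<Rightarrow> nat \<Rightarrow> real" where
  "trap_radius Left = nth [2000, 2000, 4000, 2000, 1]"
| "trap_radius Right = nth [1500, 700, 200, 300, 1]"

primrec trap_generator :: "factor \<Rightarrow> nat \<Rightarrow> nat \<Rightarrow> real" where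
  "trap_generator Left = entry
    [[0, 0, 0, 0, 0],
     [-4000, 2000, 4000, 0, 7500],
     [2000, 0, 4000, 2000, 17800],
     [2000, 0, 4000, 0, 23200],
     [0, 0, 4000, 0, 19500],
     [0, 0, 0, 0, 1]]"
| "trap_generator Right = entry
    [[0, 0, 0, 0, 0],
     [1500, 0, 0, 300, 4900],
     [1500, 0, 0, 0, 6000],
     [1500, 700, 0, 0, 3800],
     [1500, 0, 200, 0, 6400],
     [0, 0, 0, 0, 1]]"

primrec step_image :: "factor \<Rightarrow> nat \<Rightarrow> nat \<Rightarrow> real" where
  "step_image Left = entry
    [[-1306, 1985, 7636, 2166, 22028],
     [-2794, 1760, 10434, 2230, 35773],
     [1477, 1069, 8444, 1183, 38430],
     [-333, 3483, 19998, 4189, 72245],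
     [1139, 335, 8571, 337, 43795],
     [1203, 2180, 19998, 2543, 90071],
     [-548, 720, 7710, 878, 34536],
     [707, 1738, 19998, 2028, 95471],
     [-897, 2862, 19998, 3460, 79682],
     [-200, 2036, 19998, 2428, 91745]]"
| "step_image Right = entry
    [[2864, 760, -91, 293, 7011],
     [3500, 522, 17, 218, 11697],
     [3494, 217, 293, 91, 13991],
     [3167, 467, 120, 182, 10674],
     [7637, 1304, 49, 525, 23206],
     [7637, 819, 394, 333, 28161],
     [3213, 281, 232, 113, 12693],
     [7637, 1008, 285, 405, 27029],
     [7637, 778, 449, 314, 29224],
     [7637, 779, 451, 314, 29643]]"

primrec step_error :: "factor \<Rightarrow> nat \<Rightarrow> real" where
  "step_error Left = nth [2, 3, 3, 10, 4, 12, 6, 20, 22, 34]"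
| "step_error Right = nth [2, 2, 2, 3, 8, 9, 6, 14, 13, 19]"

lemmas enclosure_simps =
  trap_functional.simps trap_radius.simps trap_generator.simps step_image.simps step_error.simps

interpretation F: enclosure_data 5 "cycle_weight s" 10 "cycle_column s" "cycle_value s" "growth s" "5/16"
    "trap_functional s" "trap_radius s" "trap_generator s" "step_image s" "step_error s" for s ..

lemma rounded_step_enclosure:
  assumes "t < 10"
  shows "F.step_residual s t \<le> F.L s (F.V s t) (cycle_column s t) * step_error s t"
  using assms unfolding F.step_residual_def perturb_coef_def lin_form_def expand_sums less_10_iff
  by (elim disjE; cases s; hypsubst)
    (simp_all add: V_eq_cycle_state updates_eval cycle_simps enclosure_simps)

lemma rounded_contraction:
  assumes "i < 5" "i \<noteq> 4"
  shows "F.return_bound s i < trap_radius s i"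
  using assms unfolding F.return_bound_def expand_sums less_5_iff
  by (elim disjE; cases s; hypsubst)
    (simp_all add: V_eq_cycle_state updates_eval cycle_simps enclosure_simps)

interpretation F: certified_cycle 5 "cycle_weight s" 10 "cycle_column s" "cycle_value s" "growth s" "5/16"
    "trap_functional s" "trap_radius s" "trap_generator s" "step_image s" "step_error s" for s
proof
  show "0 < trap_radius s i" if "i < 5" for i
    using that unfolding less_5_iff
    by (elim disjE; cases s; hypsubst) (simp_all add: enclosure_simps)
  show "trap_radius s (5 - 1) = 1" by (cases s; simp add: enclosure_simps)
  show "trap_functional s (5 - 1) k = (if k = 5 then 1 else 0)" if "k \<le> 5" for k
    using that unfolding le_5_iff
    by (elim disjE; cases s; hypsubst) (simp_all add: cycle_simps enclosure_simps)
  show "(\<Sum>i<5. trap_generator s k i / trap_radius s i * trap_functional s i l) = (if k = l then 1 else 0)"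
    if "k \<le> 5" "0 < l" "l \<le> 5" for k l
    using that unfolding expand_sums le_5_iff
    by (elim disjE; cases s; hypsubst) (simp_all add: cycle_simps enclosure_simps)
  have "5 - 1 = (4 :: nat)" by simp
  then show "(\<Sum>i<5 - 1. \<bar>\<Sum>k\<le>5. F.drift_coef s k * trap_generator s k i\<bar>)
      < (\<Sum>k\<le>5. F.drift_coef s k * trap_generator s k (5 - 1))"
    unfolding F.drift_coef_def lin_form_def
    by (simp only: expand_sums, cases s; simp add: V_eq_cycle_state cycle_simps enclosure_simps)
qed (use rounded_step_enclosure rounded_contraction in auto)

lemma matrix_exists:
  obtains m M where "regular_run m 5 M" "margin m 5 M = 1/5"
    "bursts (5/16) (growth s) 10 (\<lambda>k. top_edge m 5 M (ada_iter m 5 M k))"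
proof (rule F.sign_matrix_realisation)
  let ?y = "\<lambda>k. if k \<le> 5 then trap_generator s k 4 else 0"
  have "\<bar>\<Sum>k\<le>5. trap_functional s i k * ?y k\<bar> \<le> trap_radius s i" if "i < 5" "i \<noteq> 4" for i
    using that unfolding expand_sums less_5_iff
    by (elim disjE; cases s; hypsubst) (simp_all add: cycle_simps enclosure_simps)
  then show "?y \<in> F.trap s"
    unfolding F.trap_def normalized_def by (cases s; simp add: cycle_simps enclosure_simps)
  show "?y k \<in> \<int>" if "k \<le> 5" for k
    using that unfolding le_5_iff
    by (elim disjE; cases s; hypsubst) (simp_all add: cycle_simps enclosure_simps)
  show "0 < cycle_weight s a b" if "a < 5" "b < 5" "a \<noteq> b" for a b
    using that unfolding less_5_iff
    by (elim disjE; cases s; hypsubst) (simp_all add: cycle_simps)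
qed (use that in auto)

section \<open>The counterexample\<close>

lemma growth_powers_distinct:
  assumes "0 < i" "0 < j"
  shows "growth Left ^ i \<noteq> growth Right ^ j"
proof
  assume "growth Left ^ i = growth Right ^ j"
  then have "real (5 ^ i * 11 ^ j) = real (56 ^ j)" by (simp add: power_divide)
  then have "5 ^ i * 11 ^ j = (56 :: nat) ^ j" by (simp only: of_nat_eq_iff)
  moreover have "(5 :: nat) dvd 5 ^ i * 11 ^ j" using assms(1) by (simp add: dvd_power)
  ultimately have "(5 :: nat) dvd 56 ^ j" by simp
  moreover have "prime (5 :: nat)" by simp
  ultimately have "(5 :: nat) dvd 56" using prime_dvd_power by blast
  then show False by simp
qed

theorem theorem1:
  shows "\<exists>(m::nat) (N::nat) (M::nat \<Rightarrow> nat \<Rightarrow> real).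
           0 < m \<and> 0 < N \<and> pm1_matrix m N M \<and> margin m N M = 1/5 \<and>
           \<not> conv_finite_cycle m (adaD m N M)"
proof -
  obtain m1 M1 where left: "regular_run m1 5 M1" "margin m1 5 M1 = 1/5"
    "bursts (5/16) (growth Left) 10 (\<lambda>k. top_edge m1 5 M1 (ada_iter m1 5 M1 k))"
    by (rule matrix_exists)
  obtain m2 M2 where right: "regular_run m2 5 M2" "margin m2 5 M2 = 1/5"
    "bursts (5/16) (growth Right) 10 (\<lambda>k. top_edge m2 5 M2 (ada_iter m2 5 M2 k))"
    by (rule matrix_exists)
  let ?M = "prod_mat m1 5 M1 M2"
  have pos: "0 < m1" "0 < m2" and signs: "pm1_matrix m1 5 M1" "pm1_matrix m2 5 M2"
    using left(1) right(1) by (auto simp: regular_run_def)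
  have "0 < m1 * m2" "pm1_matrix (m1 * m2) (5 + 5) ?M"
    using pos by (simp, intro pm1_matrix_prod_mat[OF signs])
  moreover have "margin (m1 * m2) (5 + 5) ?M = 1/5"
    using left(2) right(2) by (subst margin_prod_mat[OF signs pos]) simp_all
  moreover have "\<not> conv_finite_cycle (m1 * m2) (adaD (m1 * m2) (5 + 5) ?M)"
    using left(3) right(3) growth_powers_distinct
    by (intro prod_mat_not_conv_finite_cycle[OF left(1) right(1), of "5/16"]) auto
  ultimately show ?thesis
    by (intro exI[of _ "m1 * m2"] exI[of _ "5 + 5"] exI[of _ ?M]) simp
qed

end
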